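(* Consider the compound MAC model with arbitrarily correlated sources $(S_1,S_2)$ and receiver side information $(W_1,W_2)$. Let $U=f(S_1)=g(S_2)$ be the Gács–Körner common part of $S_1,S_2$. Source-channel rate $b=1$ is achievable if there is a joint distribution $$p(q,s_1,s_2,w_1,w_2,x_1,x_2,y_1,y_2)=p(q)p(s_1,s_2,w_1,w_2)p(x_1|q,s_1)p(x_2|q,s_2)p(y_1,y_2|x_1,x_2)$$ such that for both $k=1,2$: $$H(S_1|S_2,W_k)<I(X_1;Y_k|X_2,S_2,W_k,Q),\quad H(S_2|S_1,W_k)<I(X_2;Y_k|X_1,S_1,W_k,Q),$$ $$H(S_1,S_2|U,W_k)<I(X_1,X_2;Y_k|U,W_k,Q),\quad H(S_1,S_2|W_k)<I(X_1,X_2;Y_k|W_k).$$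
   Context: Compound MAC model: $\{(S_{1,k},S_{2,k},W_{1,k},W_{2,k})\}_{k\ge1}$ i.i.d. $\sim p(s_1,s_2,w_1,w_2)$ on finite alphabets. Transmitter $i\in\{1,2\}$ observes $S_i^m$ and sends $X_i^n=f_i^{(m,n)}(S_i^m)$. The channel $p(y_1,y_2|x_1,x_2)$ is discrete memoryless with finite alphabets. Receiver $k\in\{1,2\}$ observes $(Y_k^n,W_k^m)$ and outputs $(\hat S_{k,1}^m,\hat S_{k,2}^m)=g_k^{(m,n)}(Y_k^n,W_k^m)$, an estimate of both sources. Error probability $P_e^{(m,n)}=\Pr\{\bigcup_{k=1,2}\{(S_1^m,S_2^m)\neq(\hat S_{k,1}^m,\hat S_{k,2}^m)\}\}$. Rate $b$ is achievable if for every $\epsilon>0$ there exist positive integers $m,n$ with $n/m=b$ and encoders/decoders with $P_e^{(m,n)}<\epsilon$. The Gács–Körner common part is the maximal-entropy random variable $U$ with $U=f(S_1)=g(S_2)$ almost surely. *)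

theory Defs
  imports "HOL-Probability.Probability"
begin

definition pmf_entropy :: "'a pmf \<Rightarrow> real" where
  "pmf_entropy P = (\<Sum>v\<in>set_pmf P. - (pmf P v * log 2 (pmf P v)))"

definition ent :: "'o pmf \<Rightarrow> ('o \<Rightarrow> 'a) \<Rightarrow> real" where
  "ent P X = pmf_entropy (map_pmf X P)"

definition cond_ent :: "'o pmf \<Rightarrow> ('o \<Rightarrow> 'a) \<Rightarrow> ('o \<Rightarrow> 'c) \<Rightarrow> real" where
  "cond_ent P X Z = ent P (\<lambda>w. (X w, Z w)) - ent P Z"

definition cond_mi :: "'o pmf \<Rightarrow> ('o \<Rightarrow> 'a) \<Rightarrow> ('o \<Rightarrow> 'b) \<Rightarrow> ('o \<Rightarrow> 'c) \<Rightarrow> real" where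
  "cond_mi P X Y Z = cond_ent P X Z - cond_ent P X (\<lambda>w. (Y w, Z w))"

definition common_fn :: "('s1 \<times> 's2 \<times> 'w1 \<times> 'w2) pmf \<Rightarrow> ('s1 \<Rightarrow> 'u) \<Rightarrow> ('s2 \<Rightarrow> 'u) \<Rightarrow> bool" where
  "common_fn p f g = (\<forall>s1 s2 w1 w2. (s1, s2, w1, w2) \<in> set_pmf p \<longrightarrow> f s1 = g s2)"

text \<open>U = f(S1) = g(S2) is the Gacs-Koerner common part: a common function of maximal
  entropy. Any common function of S1 takes at most |S1| values, so (up to a relabelling,
  which does not change entropy) it suffices to compare with common functions valued in 's1.\<close>
definition gk_common_part :: "('s1 \<times> 's2 \<times> 'w1 \<times> 'w2) pmf \<Rightarrow> ('s1 \<Rightarrow> 'u) \<Rightarrow> ('s2 \<Rightarrow> 'u) \<Rightarrow> bool" where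
  "gk_common_part p f g =
     (common_fn p f g \<and>
      (\<forall>(f' :: 's1 \<Rightarrow> 's1) (g' :: 's2 \<Rightarrow> 's1). common_fn p f' g' \<longrightarrow>
          ent p (\<lambda>(s1, s2, w1, w2). f' s1) \<le> ent p (\<lambda>(s1, s2, w1, w2). f s1)))"

text \<open>Sequences of length m are functions on nat, only positions < m matter
  (i.i.d. products built with Pi_pmf over {..<m}).
  Encoder i maps S_i^m to X_i^n; decoder k maps (Y_k^n, W_k^m) to an estimate of (S_1^m, S_2^m).\<close>
definition mac_error_prob ::
  "('s1 \<times> 's2 \<times> 'w1 \<times> 'w2) pmf \<Rightarrow> ('x1 \<Rightarrow> 'x2 \<Rightarrow> ('y1 \<times> 'y2) pmf) \<Rightarrow> nat \<Rightarrow> nat \<Rightarrow>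
   ((nat \<Rightarrow> 's1) \<Rightarrow> (nat \<Rightarrow> 'x1)) \<Rightarrow> ((nat \<Rightarrow> 's2) \<Rightarrow> (nat \<Rightarrow> 'x2)) \<Rightarrow>
   ((nat \<Rightarrow> 'y1) \<Rightarrow> (nat \<Rightarrow> 'w1) \<Rightarrow> (nat \<Rightarrow> 's1) \<times> (nat \<Rightarrow> 's2)) \<Rightarrow>
   ((nat \<Rightarrow> 'y2) \<Rightarrow> (nat \<Rightarrow> 'w2) \<Rightarrow> (nat \<Rightarrow> 's1) \<times> (nat \<Rightarrow> 's2)) \<Rightarrow> real" where
  "mac_error_prob p W m n enc1 enc2 dec1 dec2 =
     measure_pmf.prob
       (do {
          src \<leftarrow> Pi_pmf {..<m} undefined (\<lambda>_. p);
          let s1 = (\<lambda>i. fst (src i));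
          let s2 = (\<lambda>i. fst (snd (src i)));
          let w1 = (\<lambda>i. fst (snd (snd (src i))));
          let w2 = (\<lambda>i. snd (snd (snd (src i))));
          let x1 = enc1 s1;
          let x2 = enc2 s2;
          ys \<leftarrow> Pi_pmf {..<n} undefined (\<lambda>i. W (x1 i) (x2 i));
          let y1 = (\<lambda>i. fst (ys i));
          let y2 = (\<lambda>i. snd (ys i));
          let est1 = dec1 y1 w1;
          let est2 = dec2 y2 w2;
          return_pmf
            ((\<exists>i<m. fst est1 i \<noteq> s1 i \<or> snd est1 i \<noteq> s2 i) \<or>
             (\<exists>i<m. fst est2 i \<noteq> s1 i \<or> snd est2 i \<noteq> s2 i))
        })
       {True}"

definition achievable_rate ::
  "('s1 \<times> 's2 \<times> 'w1 \<times> 'w2) pmf \<Rightarrow> ('x1 \<Rightarrow> 'x2 \<Rightarrow> ('y1 \<times> 'y2) pmf) \<Rightarrow> real \<Rightarrow> bool" where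
  "achievable_rate p W b =
     (\<forall>\<epsilon>>0. \<exists>m n enc1 enc2 dec1 dec2. m > 0 \<and> n > 0 \<and> real n / real m = b \<and>
        mac_error_prob p W m n enc1 enc2 dec1 dec2 < \<epsilon>)"

definition joint_dist ::
  "'q pmf \<Rightarrow> ('s1 \<times> 's2 \<times> 'w1 \<times> 'w2) pmf \<Rightarrow> ('q \<Rightarrow> 's1 \<Rightarrow> 'x1 pmf) \<Rightarrow> ('q \<Rightarrow> 's2 \<Rightarrow> 'x2 pmf) \<Rightarrow>
   ('x1 \<Rightarrow> 'x2 \<Rightarrow> ('y1 \<times> 'y2) pmf) \<Rightarrow>
   ('q \<times> ('s1 \<times> 's2 \<times> 'w1 \<times> 'w2) \<times> 'x1 \<times> 'x2 \<times> ('y1 \<times> 'y2)) pmf" where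
  "joint_dist pq p px1 px2 W =
     do {
       q \<leftarrow> pq;
       s \<leftarrow> p;
       x1 \<leftarrow> px1 q (fst s);
       x2 \<leftarrow> px2 q (fst (snd s));
       y \<leftarrow> W x1 x2;
       return_pmf (q, s, x1, x2, y)
     }"

definition vQ  where "vQ  = (\<lambda>(q, s, x1, x2, y). q)"
definition vS1 where "vS1 = (\<lambda>(q, (s1, s2, w1, w2), x1, x2, y). s1)"
definition vS2 where "vS2 = (\<lambda>(q, (s1, s2, w1, w2), x1, x2, y). s2)"
definition vW1 where "vW1 = (\<lambda>(q, (s1, s2, w1, w2), x1, x2, y). w1)"
definition vW2 where "vW2 = (\<lambda>(q, (s1, s2, w1, w2), x1, x2, y). w2)"
definition vX1 where "vX1 = (\<lambda>(q, s, x1, x2, y). x1)"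
definition vX2 where "vX2 = (\<lambda>(q, s, x1, x2, y). x2)"
definition vY1 where "vY1 = (\<lambda>(q, s, x1, x2, (y1, y2)). y1)"
definition vY2 where "vY2 = (\<lambda>(q, s, x1, x2, (y1, y2)). y2)"

definition receiver_conds :: "'o pmf \<Rightarrow> ('o \<Rightarrow> 'q) \<Rightarrow> ('o \<Rightarrow> 's1) \<Rightarrow> ('o \<Rightarrow> 's2) \<Rightarrow>
    ('o \<Rightarrow> 'x1) \<Rightarrow> ('o \<Rightarrow> 'x2) \<Rightarrow> ('o \<Rightarrow> 'u) \<Rightarrow> ('o \<Rightarrow> 'w) \<Rightarrow> ('o \<Rightarrow> 'y) \<Rightarrow> bool" where
  "receiver_conds P Q S1 S2 X1 X2 U Wk Yk =
     (cond_ent P S1 (\<lambda>w. (S2 w, Wk w))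
        < cond_mi P X1 Yk (\<lambda>w. (X2 w, S2 w, Wk w, Q w)) \<and>
      cond_ent P S2 (\<lambda>w. (S1 w, Wk w))
        < cond_mi P X2 Yk (\<lambda>w. (X1 w, S1 w, Wk w, Q w)) \<and>
      cond_ent P (\<lambda>w. (S1 w, S2 w)) (\<lambda>w. (U w, Wk w))
        < cond_mi P (\<lambda>w. (X1 w, X2 w)) Yk (\<lambda>w. (U w, Wk w, Q w)) \<and>
      cond_ent P (\<lambda>w. (S1 w, S2 w)) Wk
        < cond_mi P (\<lambda>w. (X1 w, X2 w)) Yk Wk)"

end

theory Submission
  imports Defs
begin

text \<open>
  Random coding with a threshold decoder. Independent time-sharing words are drawn for every value
  of the common part, and given these independent channel words for every source word. A receiver
  looks for a source pair passing four tests, each asking that a product of a source probability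
  and an information density exceed a threshold. By a change of measure, the expected number of
  wrong candidates passing the test for their error type is at most the reciprocal of the threshold;
  no typicality or counting argument is needed. For i.i.d. sequences the tested quantities are
  products over the letters whose logarithmic drift is the gap in one of the four inequalities, so
  a Chernoff bound lets the threshold grow exponentially while the true pair still passes.
  A wrong common part comes with an independent time-sharing word, which is why the last inequality
  is not conditioned on the time-sharing variable.
\<close>

subsection \<open>Information ratios and the union bound\<close>

text \<open>The posterior probability of \<open>a\<close> given \<open>b\<close> times the information density of \<open>x\<close> and \<open>y\<close>
  given \<open>z\<close>. A conditioning event of probability 0 makes it 0, so that the test fails.\<close>
definition info_ratio ::
  "'o pmf \<Rightarrow> ('o \<Rightarrow> 'a) \<Rightarrow> ('o \<Rightarrow> 'b) \<Rightarrow> ('o \<Rightarrow> 'x) \<Rightarrow> ('o \<Rightarrow> 'y) \<Rightarrow> ('o \<Rightarrow> 'z) \<Rightarrow>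
   'a \<Rightarrow> 'b \<Rightarrow> 'x \<Rightarrow> 'y \<Rightarrow> 'z \<Rightarrow> real" where
  "info_ratio P A B X Y Z a b x y z =
     pmf (map_pmf (\<lambda>w. (A w, B w)) P) (a, b) / pmf (map_pmf B P) b *
     (pmf (map_pmf (\<lambda>w. (X w, Y w, Z w)) P) (x, y, z) * pmf (map_pmf Z P) z /
      (pmf (map_pmf (\<lambda>w. (X w, Z w)) P) (x, z) * pmf (map_pmf (\<lambda>w. (Y w, Z w)) P) (y, z)))"

text \<open>The summands are probabilities of disjoint events inside the event that \<open>B\<close>
  equals \<open>b\<close>. Equality may fail because \<open>S\<close> can miss values of
  \<open>A\<close>.\<close>

lemma sum_pmf_joint_le:
  assumes "finite S"
  shows "(\<Sum>a\<in>S. pmf (map_pmf (\<lambda>w. (A w, B w)) P) (a, b)) \<le> pmf (map_pmf B P) b"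
proof -
  have "(\<Sum>a\<in>S. pmf (map_pmf (\<lambda>w. (A w, B w)) P) (a, b))
      = measure_pmf.prob (map_pmf (\<lambda>w. (A w, B w)) P) ((\<lambda>a. (a, b)) ` S)"
    using assms by (subst measure_measure_pmf_finite) (auto simp: sum.reindex inj_on_def)
  also have "\<dots> \<le> pmf (map_pmf B P) b"
    by (auto simp: pmf_map intro!: measure_pmf.finite_measure_mono)
  finally show ?thesis .
qed

lemma sum_pmf_joint_middle_le:
  assumes "finite S"
  shows "(\<Sum>y\<in>S. pmf (map_pmf (\<lambda>w. (X w, Y w, Z w)) P) (x, y, z))
       \<le> pmf (map_pmf (\<lambda>w. (X w, Z w)) P) (x, z)"
proof -
  have "pmf (map_pmf (\<lambda>w. (X w, Y w, Z w)) P) (x, y, z)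
      = pmf (map_pmf (\<lambda>w. (Y w, X w, Z w)) P) (y, x, z)" for y
    by (simp add: pmf_map vimage_def conj_ac)
  then show ?thesis
    using sum_pmf_joint_le[OF assms, of Y "\<lambda>w. (X w, Z w)" P "(x, z)"] by simp
qed

text \<open>The change of measure: the ratio equals \<open>pa * py\<close> times the weight of
  \<open>z\<close> divided by the weight of \<open>(y, z)\<close>, so passing the test can be solved
  for the weight of \<open>(y, z)\<close>.\<close>

lemma info_ratio_exceeds:
  fixes P A B X Y Z a b x y z
  defines "pa \<equiv> pmf (map_pmf (\<lambda>w. (A w, B w)) P) (a, b) / pmf (map_pmf B P) b"
  defines "py \<equiv> pmf (map_pmf (\<lambda>w. (X w, Y w, Z w)) P) (x, y, z) / pmf (map_pmf (\<lambda>w. (X w, Z w)) P) (x, z)"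
  assumes "0 < T" "T < info_ratio P A B X Y Z a b x y z"
  shows "pmf (map_pmf (\<lambda>w. (Y w, Z w)) P) (y, z) \<le> pa * py * pmf (map_pmf Z P) z / T"
proof -
  define m where "m = pmf (map_pmf (\<lambda>w. (Y w, Z w)) P) (y, z)"
  have eq: "info_ratio P A B X Y Z a b x y z = pa * py * pmf (map_pmf Z P) z / m"
    by (simp add: info_ratio_def pa_def py_def m_def)
  \<comment> \<open>If \<open>m\<close> were 0, division by 0 would make the ratio 0, which does not
    exceed the positive \<open>T\<close>.\<close>
  have "m > 0"
    using assms(3,4) eq by (metis division_ring_divide_zero m_def order.asym order.strict_trans pmf_pos)
  then have "m * T < pa * py * pmf (map_pmf Z P) z"
    using assms(4) unfolding eq by (simp add: field_simps)
  then show ?thesis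
    using assms(3) by (simp add: field_simps m_def)
qed

text \<open>Exceeding the threshold bounds the true weight of \<open>(y, z)\<close> by a conditional probability of \<open>y\<close>
  given the candidate, which sums to at most 1 over \<open>y\<close>, whatever the law of the candidate is. Hence
  no Markov property of the joint distribution is used.\<close>
lemma threshold_union_bound:
  fixes \<kappa> :: "'z \<Rightarrow> 'a \<Rightarrow> 'r pmf"
  assumes fin: "finite (set_pmf P)" "finite S" and T: "0 < T"
  shows "(\<integral>\<^sup>+w. (\<Sum>a\<in>S. \<integral>\<^sup>+r. of_bool
            (T < info_ratio P A B X Y Z a (\<beta> (Z w)) (\<xi> (Z w) a r) (Y w) (Z w)) \<partial>\<kappa> (Z w) a) \<partial>P)
         \<le> ennreal (1 / T)"
proof -
  define PZ where "PZ z = pmf (map_pmf Z P) z" for z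
  define PYZ where "PYZ y z = pmf (map_pmf (\<lambda>w. (Y w, Z w)) P) (y, z)" for y z
  define al where "al a z = pmf (map_pmf (\<lambda>w. (A w, B w)) P) (a, \<beta> z) / pmf (map_pmf B P) (\<beta> z)" for a z
  define ga where "ga x y z = pmf (map_pmf (\<lambda>w. (X w, Y w, Z w)) P) (x, y, z) / pmf (map_pmf (\<lambda>w. (X w, Z w)) P) (x, z)" for x y z
  define D where "D a r y z \<longleftrightarrow> T < info_ratio P A B X Y Z a (\<beta> z) (\<xi> z a r) y z" for a r y z
  define Ys where "Ys = Y ` set_pmf P"
  define Zs where "Zs = Z ` set_pmf P"
  have fYZ: "finite Ys" "finite Zs" using fin by (auto simp: Ys_def Zs_def)
  have nn: "0 \<le> al a z" "0 \<le> ga x y z" "0 \<le> PZ z" for a x y z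
    by (auto simp: al_def ga_def PZ_def)
  \<comment> \<open>Conditional probabilities sum to at most 1; for a conditioning event of
    probability 0 all quotients are 0 by convention.\<close>
  have al: "(\<Sum>a\<in>S. al a z) \<le> 1" for z
    unfolding al_def sum_divide_distrib[symmetric]
    using sum_pmf_joint_le[OF fin(2), of A B P "\<beta> z"]
    by (cases "pmf (map_pmf B P) (\<beta> z) = 0") (auto simp: divide_le_eq pmf_nonneg less_le)
  have ga: "(\<Sum>y\<in>Ys. ga x y z) \<le> 1" for x z
    unfolding ga_def sum_divide_distrib[symmetric]
    using sum_pmf_joint_middle_le[OF fYZ(1), of X Y Z P x z]
    by (cases "pmf (map_pmf (\<lambda>w. (X w, Z w)) P) (x, z) = 0") (auto simp: divide_le_eq pmf_nonneg less_le)
  have PZ: "(\<Sum>z\<in>Zs. PZ z) \<le> 1"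
    unfolding PZ_def by (subst measure_measure_pmf_finite[symmetric]) (use fYZ in auto)
  have "(\<integral>\<^sup>+w. (\<Sum>a\<in>S. \<integral>\<^sup>+r. of_bool (D a r (Y w) (Z w)) \<partial>\<kappa> (Z w) a) \<partial>P)
      = (\<integral>\<^sup>+v. (\<Sum>a\<in>S. \<integral>\<^sup>+r. of_bool (D a r (fst v) (snd v)) \<partial>\<kappa> (snd v) a)
            \<partial>map_pmf (\<lambda>w. (Y w, Z w)) P)"
    by simp
  also have "\<dots> = (\<Sum>v\<in>Ys \<times> Zs. (\<Sum>a\<in>S. \<integral>\<^sup>+r. of_bool (D a r (fst v) (snd v)) \<partial>\<kappa> (snd v) a)
      * ennreal (pmf (map_pmf (\<lambda>w. (Y w, Z w)) P) v))"
    by (rule nn_integral_measure_pmf_support) (use fYZ in \<open>auto simp: Ys_def Zs_def\<close>)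
  also have "\<dots> = (\<Sum>y\<in>Ys. \<Sum>z\<in>Zs. \<Sum>a\<in>S. \<integral>\<^sup>+r. of_bool (D a r y z) * ennreal (PYZ y z) \<partial>\<kappa> z a)"
    by (simp add: sum.cartesian_product' sum_distrib_right nn_integral_multc PYZ_def)
  also have "\<dots> \<le> (\<Sum>y\<in>Ys. \<Sum>z\<in>Zs. \<Sum>a\<in>S. \<integral>\<^sup>+r. ennreal (al a z * PZ z / T * ga (\<xi> z a r) y z) \<partial>\<kappa> z a)"
  proof (intro sum_mono nn_integral_mono)
    fix y z a r
    show "of_bool (D a r y z) * ennreal (PYZ y z) \<le> ennreal (al a z * PZ z / T * ga (\<xi> z a r) y z)"
    proof (cases "D a r y z")
      case True
      then have "PYZ y z \<le> al a z * ga (\<xi> z a r) y z * PZ z / T"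
        unfolding D_def PYZ_def al_def ga_def PZ_def
        by (intro info_ratio_exceeds T)
      then show ?thesis using True by (simp add: mult_ac ennreal_leI)
    qed auto
  qed
  also have "\<dots> = (\<Sum>z\<in>Zs. \<Sum>a\<in>S. \<Sum>y\<in>Ys. \<integral>\<^sup>+r. ennreal (al a z * PZ z / T * ga (\<xi> z a r) y z) \<partial>\<kappa> z a)"
    by (subst sum.swap, rule sum.cong[OF refl], rule sum.swap)
  \<comment> \<open>The candidate law \<open>\<kappa> z a\<close> does not depend on
    \<open>y\<close>, so the sum over \<open>y\<close> can be taken inside the integral, where
    \<open>ga\<close> bounds it for each fixed \<open>r\<close>.\<close>
  also have "\<dots> = (\<Sum>z\<in>Zs. \<Sum>a\<in>S. \<integral>\<^sup>+r. ennreal (al a z * PZ z / T * (\<Sum>y\<in>Ys. ga (\<xi> z a r) y z)) \<partial>\<kappa> z a)"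
    using nn T by (simp add: nn_integral_sum[symmetric] sum_distrib_left sum_ennreal)
  also have "\<dots> \<le> (\<Sum>z\<in>Zs. \<Sum>a\<in>S. \<integral>\<^sup>+r. ennreal (al a z * PZ z / T * 1) \<partial>\<kappa> z a)"
    using nn T ga by (intro sum_mono nn_integral_mono ennreal_leI mult_left_mono) auto
  also have "\<dots> = ennreal (\<Sum>z\<in>Zs. PZ z / T * (\<Sum>a\<in>S. al a z))"
    using nn T by (simp add: sum_ennreal sum_nonneg sum_distrib_left mult_ac)
  also have "\<dots> \<le> ennreal (\<Sum>z\<in>Zs. PZ z / T * 1)"
    using nn T al by (intro ennreal_leI sum_mono mult_left_mono) auto
  also have "\<dots> \<le> ennreal (1 / T)"
    using PZ T by (intro ennreal_leI) (simp add: sum_divide_distrib[symmetric] divide_right_mono)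
  finally show ?thesis unfolding D_def .
qed

subsection \<open>The random code\<close>

text \<open>Tonelli for two discrete distributions, read off from the symmetry of
  \<open>pair_pmf\<close>, so that no measurability or sigma-finiteness has to be checked.\<close>

lemma nn_integral_pmf_commute:
  "(\<integral>\<^sup>+x. \<integral>\<^sup>+y. F x y \<partial>measure_pmf N \<partial>measure_pmf M) = (\<integral>\<^sup>+y. \<integral>\<^sup>+x. F x y \<partial>measure_pmf M \<partial>measure_pmf N)"
proof -
  have "(\<integral>\<^sup>+v. F (fst v) (snd v) \<partial>pair_pmf M N) = (\<integral>\<^sup>+v. F (snd v) (fst v) \<partial>pair_pmf N M)"
    by (subst pair_commute_pmf) (simp add: case_prod_beta)
  then show ?thesis by (simp add: nn_integral_pair_pmf')
qed

lemma nn_integral_Pi_pmf_component: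
  assumes "finite A" "a \<in> A"
  shows "(\<integral>\<^sup>+h. F (h a) \<partial>Pi_pmf A d p) = (\<integral>\<^sup>+x. F x \<partial>p a)"
  using nn_integral_map_pmf[where f = F and g = "\<lambda>h. h a" and M = "Pi_pmf A d p"] assms
  by (simp add: Pi_pmf_component)

text \<open>Distinct coordinates of a product distribution are independent: coordinate
  \<open>a\<close> is split off, and \<open>b\<close> is still a coordinate of the remaining
  product.\<close>

lemma nn_integral_Pi_pmf_two_components:
  assumes "finite A" "a \<in> A" "b \<in> A" "a \<noteq> b"
  shows "(\<integral>\<^sup>+h. F (h a) (h b) \<partial>Pi_pmf A d p) = (\<integral>\<^sup>+x. \<integral>\<^sup>+y. F x y \<partial>p b \<partial>p a)"
proof -
  have "Pi_pmf A d p = Pi_pmf (insert a (A - {a})) d p"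
    using assms by (simp add: insert_absorb)
  also have "\<dots> = do {y \<leftarrow> p a; h \<leftarrow> Pi_pmf (A - {a}) d p; return_pmf (h(a := y))}"
    using assms by (intro Pi_pmf_insert') auto
  finally have "(\<integral>\<^sup>+h. F (h a) (h b) \<partial>Pi_pmf A d p)
      = (\<integral>\<^sup>+x. \<integral>\<^sup>+h. F x (h b) \<partial>Pi_pmf (A - {a}) d p \<partial>p a)"
    using assms by simp
  also have "\<dots> = (\<integral>\<^sup>+x. \<integral>\<^sup>+y. F x y \<partial>p b \<partial>p a)"
    using assms by (subst nn_integral_Pi_pmf_component) auto
  finally show ?thesis .
qed

text \<open>Each encoder can compute the common value from its own source, by \<open>f\<close> or by
  \<open>g\<close>, and so both look up the same entry of \<open>cq\<close>. The union of the two
  images ensures that every entry looked up has been drawn.\<close>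

definition random_code ::
  "'q pmf \<Rightarrow> ('q \<Rightarrow> 'a \<Rightarrow> 'x1 pmf) \<Rightarrow> ('q \<Rightarrow> 'b \<Rightarrow> 'x2 pmf) \<Rightarrow> ('a \<Rightarrow> 'u) \<Rightarrow> ('b \<Rightarrow> 'u) \<Rightarrow>
   'a set \<Rightarrow> 'b set \<Rightarrow> (('u \<Rightarrow> 'q) \<times> ('a \<Rightarrow> 'x1) \<times> ('b \<Rightarrow> 'x2)) pmf" where
  "random_code pq k1 k2 f g A B = do {
     cq \<leftarrow> Pi_pmf (f ` A \<union> g ` B) undefined (\<lambda>_. pq);
     c1 \<leftarrow> Pi_pmf A undefined (\<lambda>a. k1 (cq (f a)) a);
     c2 \<leftarrow> Pi_pmf B undefined (\<lambda>b. k2 (cq (g b)) b);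
     return_pmf (cq, c1, c2)}"

lemma nn_integral_random_code:
  "(\<integral>\<^sup>+c. F c \<partial>random_code pq k1 k2 f g A B) =
   (\<integral>\<^sup>+cq. \<integral>\<^sup>+c1. \<integral>\<^sup>+c2. F (cq, c1, c2) \<partial>Pi_pmf B undefined (\<lambda>b. k2 (cq (g b)) b)
      \<partial>Pi_pmf A undefined (\<lambda>a. k1 (cq (f a)) a) \<partial>Pi_pmf (f ` A \<union> g ` B) undefined (\<lambda>_. pq))"
  by (simp add: random_code_def)

section \<open>Joint laws of the codewords of the true pair and of one rival\<close>

context
  fixes pq :: "'q pmf" and k1 :: "'q \<Rightarrow> 'a \<Rightarrow> 'x1 pmf" and k2 :: "'q \<Rightarrow> 'b \<Rightarrow> 'x2 pmf"
    and f :: "'a \<Rightarrow> 'u" and g :: "'b \<Rightarrow> 'u" and A :: "'a set" and B :: "'b set" and a b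
  assumes fin: "finite A" "finite B" and ab: "a \<in> A" "b \<in> B" "f a = g b"
begin

lemma random_code_marginal:
  "(\<integral>\<^sup>+(cq, c1, c2). F (cq (f a)) (c1 a) (c2 b) \<partial>random_code pq k1 k2 f g A B) =
   (\<integral>\<^sup>+q. \<integral>\<^sup>+x1. \<integral>\<^sup>+x2. F q x1 x2 \<partial>k2 q b \<partial>k1 q a \<partial>pq)"
  using fin ab
  by (simp add: nn_integral_random_code nn_integral_Pi_pmf_component[where F = "F _ _"]
      nn_integral_Pi_pmf_component[where A = A and F = "\<lambda>x1. \<integral>\<^sup>+x2. F _ x1 x2 \<partial>_"]
      nn_integral_Pi_pmf_component[where F = "\<lambda>q. \<integral>\<^sup>+x1. \<integral>\<^sup>+x2. F q x1 x2 \<partial>k2 q b \<partial>k1 q a"])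

text \<open>A rival \<open>a'\<close> with the true common value shares the entry of
  \<open>cq\<close> with \<open>a\<close>, but its codeword is a separate coordinate of
  \<open>c1\<close>: given \<open>q\<close>, it is independent of the true codewords.\<close>

lemma random_code_marginal_other_a:
  assumes "a' \<in> A" "a' \<noteq> a" "f a' = f a"
  shows "(\<integral>\<^sup>+(cq, c1, c2). F (cq (f a)) (c1 a) (c2 b) (c1 a') \<partial>random_code pq k1 k2 f g A B) =
   (\<integral>\<^sup>+q. \<integral>\<^sup>+x1. \<integral>\<^sup>+x2. \<integral>\<^sup>+r. F q x1 x2 r \<partial>k1 q a' \<partial>k2 q b \<partial>k1 q a \<partial>pq)"
  apply (simp add: nn_integral_random_code)
  apply (subst nn_integral_Pi_pmf_component[OF fin(2) ab(2)])
  apply (subst nn_integral_Pi_pmf_two_components[OF fin(1) ab(1) assms(1) assms(2)[symmetric]])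
  \<comment> \<open>The rival codeword is drawn together with \<open>c1\<close>; it is moved behind
    the true \<open>x2\<close> so that it is integrated innermost.\<close>
  apply (subst nn_integral_pmf_commute[where N = "k2 _ _"])
  using fin ab assms
  apply (simp add: nn_integral_Pi_pmf_component[where F = "\<lambda>q. \<integral>\<^sup>+x1. \<integral>\<^sup>+x2. \<integral>\<^sup>+r. F q x1 x2 r \<partial>k1 q a' \<partial>k2 q b \<partial>k1 q a"])
  done

lemma random_code_marginal_other_b:
  assumes "b' \<in> B" "b' \<noteq> b" "g b' = f a"
  shows "(\<integral>\<^sup>+(cq, c1, c2). F (cq (f a)) (c1 a) (c2 b) (c2 b') \<partial>random_code pq k1 k2 f g A B) =
   (\<integral>\<^sup>+q. \<integral>\<^sup>+x1. \<integral>\<^sup>+x2. \<integral>\<^sup>+r. F q x1 x2 r \<partial>k2 q b' \<partial>k2 q b \<partial>k1 q a \<partial>pq)"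
  apply (simp add: nn_integral_random_code)
  apply (subst nn_integral_Pi_pmf_two_components[OF fin(2) ab(2) assms(1) assms(2)[symmetric]])
  apply (subst nn_integral_Pi_pmf_component[OF fin(1) ab(1)])
  using fin ab assms
  apply (simp add: nn_integral_Pi_pmf_component[where F = "\<lambda>q. \<integral>\<^sup>+x1. \<integral>\<^sup>+x2. \<integral>\<^sup>+r. F q x1 x2 r \<partial>k2 q b' \<partial>k2 q b \<partial>k1 q a"])
  done

lemma random_code_marginal_other_pair:
  assumes "a' \<in> A" "a' \<noteq> a" "f a' = f a" and "b' \<in> B" "b' \<noteq> b" "g b' = f a"
  shows "(\<integral>\<^sup>+(cq, c1, c2). F (cq (f a)) (c1 a) (c2 b) (c1 a') (c2 b') \<partial>random_code pq k1 k2 f g A B) =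
   (\<integral>\<^sup>+q. \<integral>\<^sup>+x1. \<integral>\<^sup>+x2. \<integral>\<^sup>+r. F q x1 x2 (fst r) (snd r) \<partial>pair_pmf (k1 q a') (k2 q b') \<partial>k2 q b \<partial>k1 q a \<partial>pq)"
  apply (simp add: nn_integral_random_code nn_integral_pair_pmf')
  apply (subst nn_integral_Pi_pmf_two_components[OF fin(2) ab(2) assms(4) assms(5)[symmetric]])
  apply (subst nn_integral_Pi_pmf_two_components[OF fin(1) ab(1) assms(1) assms(2)[symmetric]])
  apply (subst nn_integral_pmf_commute[where N = "k2 _ b"])
  using fin ab assms
  apply (simp add: nn_integral_Pi_pmf_component[where F = "\<lambda>q. \<integral>\<^sup>+x1. \<integral>\<^sup>+x2. \<integral>\<^sup>+r. \<integral>\<^sup>+s. F q x1 x2 r s \<partial>k2 q b' \<partial>k1 q a' \<partial>k2 q b \<partial>k1 q a"])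
  done

text \<open>A wrong common value reads a different coordinate of \<open>cq\<close>. The rival
  therefore has its own independent time-sharing value \<open>q'\<close>, which only enters averaged
  into the law of the rival codewords.\<close>

lemma random_code_marginal_other_common:
  assumes "a' \<in> A" "f a' \<noteq> f a" and "b' \<in> B" "g b' = f a'"
  shows "(\<integral>\<^sup>+(cq, c1, c2). F (cq (f a)) (c1 a) (c2 b) (c1 a') (c2 b') \<partial>random_code pq k1 k2 f g A B) =
   (\<integral>\<^sup>+q. \<integral>\<^sup>+x1. \<integral>\<^sup>+x2. \<integral>\<^sup>+r. F q x1 x2 (fst r) (snd r)
       \<partial>bind_pmf pq (\<lambda>q'. pair_pmf (k1 q' a') (k2 q' b')) \<partial>k2 q b \<partial>k1 q a \<partial>pq)"
proof -
  have ne: "a \<noteq> a'" "b \<noteq> b'" and u: "f a \<in> f ` A \<union> g ` B" "f a' \<in> f ` A \<union> g ` B"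
    using assms ab by auto
  show ?thesis
    apply (simp add: nn_integral_random_code nn_integral_pair_pmf')
    apply (subst nn_integral_Pi_pmf_two_components[OF fin(2) ab(2) assms(3) ne(2)])
    apply (subst nn_integral_Pi_pmf_two_components[OF fin(1) ab(1) assms(1) ne(1)])
    apply (subst nn_integral_pmf_commute[where N = "k2 _ b"])
    apply (simp add: ab(3)[symmetric] assms(4))
    apply (subst nn_integral_Pi_pmf_two_components[where F = "\<lambda>q q'. \<integral>\<^sup>+x1. \<integral>\<^sup>+x2. \<integral>\<^sup>+r. \<integral>\<^sup>+s. F q x1 x2 r s \<partial>k2 q' b' \<partial>k1 q' a' \<partial>k2 q b \<partial>k1 q a"])
    using fin assms u apply auto[4]
    \<comment> \<open>The fresh \<open>q'\<close> is moved inwards past both true codewords, where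
      it becomes part of the rival law.\<close>
    apply (subst nn_integral_pmf_commute[where M = pq and N = "k1 _ a"])
    apply (subst nn_integral_pmf_commute[where M = pq and N = "k2 _ b"])
    apply (rule refl)
    done
qed

end

subsection \<open>Threshold decoding\<close>

text \<open>The source is integrated before \<open>q\<close>, unlike in the definition, because the
  error analysis fixes the source outcome first and then averages over the code.\<close>

lemma nn_integral_joint_dist:
  "(\<integral>\<^sup>+w. F w \<partial>joint_dist pq p k1 k2 V) =
   (\<integral>\<^sup>+s. \<integral>\<^sup>+q. \<integral>\<^sup>+x1. \<integral>\<^sup>+x2. \<integral>\<^sup>+y. F (q, s, x1, x2, y)
      \<partial>V x1 x2 \<partial>k2 q (fst (snd s)) \<partial>k1 q (fst s) \<partial>pq \<partial>p)"
  by (simp add: joint_dist_def) (rule nn_integral_pmf_commute)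

text \<open>The four ratios that follow correspond to the four inequalities of
  \<open>receiver_conds\<close>: the mean logarithm of each is the right side minus the left side.
  The arguments \<open>a\<close>, \<open>b\<close>, \<open>x1\<close>, \<open>x2\<close> belong to
  the candidate under test.\<close>

definition source1_ratio where
  "source1_ratio P Wk Yk q a b w x1 x2 y =
     info_ratio P vS1 (\<lambda>v. (vS2 v, Wk v)) vX1 Yk (\<lambda>v. (vX2 v, vS2 v, Wk v, vQ v))
       a (b, w) x1 y (x2, b, w, q)"

definition source2_ratio where
  "source2_ratio P Wk Yk q a b w x1 x2 y =
     info_ratio P vS2 (\<lambda>v. (vS1 v, Wk v)) vX2 Yk (\<lambda>v. (vX1 v, vS1 v, Wk v, vQ v))
       b (a, w) x2 y (x1, a, w, q)"

definition pair_ratio_given_common where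
  "pair_ratio_given_common P f Wk Yk u q a b w x1 x2 y =
     info_ratio P (\<lambda>v. (vS1 v, vS2 v)) (\<lambda>v. (f (vS1 v), Wk v)) (\<lambda>v. (vX1 v, vX2 v)) Yk
       (\<lambda>v. (f (vS1 v), Wk v, vQ v)) (a, b) (u, w) (x1, x2) y (u, w, q)"

definition pair_ratio where
  "pair_ratio P Wk Yk a b w x1 x2 y =
     info_ratio P (\<lambda>v. (vS1 v, vS2 v)) Wk (\<lambda>v. (vX1 v, vX2 v)) Yk Wk (a, b) w (x1, x2) y w"

text \<open>The condition \<open>f a = g b\<close> discards pairs without a common value. With it,
  every wrong candidate belongs to one of the error classes covered by the four tests.\<close>

definition accepts where
  "accepts T P f g Wk Yk q a b w x1 x2 y \<longleftrightarrow> f a = g b \<and>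
     T < source1_ratio P Wk Yk q a b w x1 x2 y \<and> T < source2_ratio P Wk Yk q a b w x1 x2 y \<and>
     T < pair_ratio_given_common P f Wk Yk (f a) q a b w x1 x2 y \<and> T < pair_ratio P Wk Yk a b w x1 x2 y"

text \<open>Any passing candidate may be chosen. If none passes the output is arbitrary, which is
  charged to the rejection of the true pair.\<close>

definition decode where
  "decode T P f g Wk Yk A B cq c1 c2 y w =
     (SOME v. fst v \<in> A \<and> snd v \<in> B \<and>
        accepts T P f g Wk Yk (cq (f (fst v))) (fst v) (snd v) w (c1 (fst v)) (c2 (snd v)) y)"

lemma one_le_sum_of_bool:
  "finite I \<Longrightarrow> i \<in> I \<Longrightarrow> R i \<Longrightarrow> (1 :: ennreal) \<le> (\<Sum>i\<in>I. of_bool (R i))"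
  using member_le_sum[of i I "\<lambda>i. of_bool (R i) :: ennreal"] by simp

text \<open>The candidates are split according to which sources they get wrong, and, if both, whether
  the common part is still right; each class is ruled out by one of the four tests.\<close>
lemma decode_error_cases:
  fixes f :: "'a \<Rightarrow> 'u" and g :: "'b \<Rightarrow> 'u" and cq a b w y
  assumes "finite A" "finite B" "a \<in> A" "b \<in> B" "f a = g b"
  defines "A' \<equiv> {a'\<in>A. a' \<noteq> a \<and> f a' = f a}" and "B' \<equiv> {b'\<in>B. b' \<noteq> b \<and> g b' = f a}"
  shows "(of_bool (decode T P f g Wk Yk A B cq c1 c2 y w \<noteq> (a, b)) :: ennreal) \<le>
    of_bool (\<not> accepts T P f g Wk Yk (cq (f a)) a b w (c1 a) (c2 b) y) +
    (\<Sum>a'\<in>A'. of_bool (T < source1_ratio P Wk Yk (cq (f a)) a' b w (c1 a') (c2 b) y)) +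
    (\<Sum>b'\<in>B'. of_bool (T < source2_ratio P Wk Yk (cq (f a)) a b' w (c1 a) (c2 b') y)) +
    (\<Sum>v\<in>A' \<times> B'. of_bool (T < pair_ratio_given_common P f Wk Yk (f a) (cq (f a)) (fst v) (snd v) w (c1 (fst v)) (c2 (snd v)) y)) +
    (\<Sum>v\<in>{v\<in>A \<times> B. f (fst v) = g (snd v) \<and> f (fst v) \<noteq> f a}.
       of_bool (T < pair_ratio P Wk Yk (fst v) (snd v) w (c1 (fst v)) (c2 (snd v)) y))"
    (is "_ \<le> ?e0 + ?e1 + ?e2 + ?e3 + ?e4")
proof (cases "decode T P f g Wk Yk A B cq c1 c2 y w \<noteq> (a, b)
    \<and> accepts T P f g Wk Yk (cq (f a)) a b w (c1 a) (c2 b) y")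
  case True
  define v where "v = decode T P f g Wk Yk A B cq c1 c2 y w"
  have "fst v \<in> A \<and> snd v \<in> B \<and>
        accepts T P f g Wk Yk (cq (f (fst v))) (fst v) (snd v) w (c1 (fst v)) (c2 (snd v)) y"
    \<comment> \<open>The true pair passes, so the choice is from a nonempty set and the decoded
      pair passes as well.\<close>
    unfolding v_def decode_def by (rule someI[where x = "(a, b)"]) (use True assms in auto)
  then have v: "fst v \<in> A" "snd v \<in> B" "f (fst v) = g (snd v)"
    and t: "T < source1_ratio P Wk Yk (cq (f (fst v))) (fst v) (snd v) w (c1 (fst v)) (c2 (snd v)) y"
    "T < source2_ratio P Wk Yk (cq (f (fst v))) (fst v) (snd v) w (c1 (fst v)) (c2 (snd v)) y"
    "T < pair_ratio_given_common P f Wk Yk (f (fst v)) (cq (f (fst v))) (fst v) (snd v) w (c1 (fst v)) (c2 (snd v)) y"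
    "T < pair_ratio P Wk Yk (fst v) (snd v) w (c1 (fst v)) (c2 (snd v)) y"
    by (auto simp: accepts_def)
  have fin: "finite A'" "finite B'" "finite (A' \<times> B')"
    "finite {v\<in>A \<times> B. f (fst v) = g (snd v) \<and> f (fst v) \<noteq> f a}"
    using assms(1,2) by (auto simp: A'_def B'_def)
  have "v \<noteq> (a, b)" using True v_def by simp
  \<comment> \<open>If exactly one source is wrong, the other one is right and fixes the common
    value; only when both are wrong can it differ.\<close>
  then consider "f (fst v) \<noteq> f a" | "f (fst v) = f a" "fst v \<noteq> a" "snd v = b"
    | "fst v = a" "snd v \<noteq> b" | "f (fst v) = f a" "fst v \<noteq> a" "snd v \<noteq> b"
    by (metis prod.collapse)
  then have "1 \<le> ?e1 \<or> 1 \<le> ?e2 \<or> 1 \<le> ?e3 \<or> 1 \<le> ?e4"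
  proof cases
    case 1
    then show ?thesis using v t by (intro disjI2 one_le_sum_of_bool[OF fin(4), of v]) (auto simp: mem_Times_iff)
  next
    case 2
    then show ?thesis using v t by (intro disjI1 one_le_sum_of_bool[OF fin(1), of "fst v"]) (auto simp: A'_def)
  next
    case 3
    then have "1 \<le> ?e2" using v t by (intro one_le_sum_of_bool[OF fin(2), of "snd v"]) (auto simp: B'_def)
    then show ?thesis by simp
  next
    case 4
    then have "1 \<le> ?e3" using v t by (intro one_le_sum_of_bool[OF fin(3), of v]) (auto simp: A'_def B'_def mem_Times_iff)
    then show ?thesis by simp
  qed
  then show ?thesis
    using True by (elim disjE) (simp_all add: add_increasing add_increasing2)
next
  case False
  show ?thesis
  proof (cases "decode T P f g Wk Yk A B cq c1 c2 y w = (a, b)")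
    case False
    then have "(1 :: ennreal) \<le> ?e0"
      using \<open>\<not> (_ \<and> _)\<close> by simp
    then show ?thesis
      using False by (simp add: add_increasing2)
  qed simp
qed

section \<open>Average error of the random code at one receiver\<close>

context
  fixes pq :: "'q pmf" and p :: "('a \<times> 'b \<times> 'w1 \<times> 'w2) pmf" and k1 :: "'q \<Rightarrow> 'a \<Rightarrow> 'x1 pmf"
    and k2 :: "'q \<Rightarrow> 'b \<Rightarrow> 'x2 pmf" and V :: "'x1 \<Rightarrow> 'x2 \<Rightarrow> ('y1 \<times> 'y2) pmf"
    and f :: "'a \<Rightarrow> 'u" and g :: "'b \<Rightarrow> 'u" and A :: "'a set" and B :: "'b set"
    and wk :: "'w1 \<times> 'w2 \<Rightarrow> 'w" and yk :: "'y1 \<times> 'y2 \<Rightarrow> 'y" and T :: real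
    and P :: "('q \<times> ('a \<times> 'b \<times> 'w1 \<times> 'w2) \<times> 'x1 \<times> 'x2 \<times> 'y1 \<times> 'y2) pmf"
    and Wk :: "'q \<times> ('a \<times> 'b \<times> 'w1 \<times> 'w2) \<times> 'x1 \<times> 'x2 \<times> 'y1 \<times> 'y2 \<Rightarrow> 'w"
    and Yk :: "'q \<times> ('a \<times> 'b \<times> 'w1 \<times> 'w2) \<times> 'x1 \<times> 'x2 \<times> 'y1 \<times> 'y2 \<Rightarrow> 'y"
  assumes fin: "finite A" "finite B"
    and supp: "\<And>s. s \<in> set_pmf p \<Longrightarrow> fst s \<in> A \<and> fst (snd s) \<in> B \<and> f (fst s) = g (fst (snd s))"
    and T: "0 < T"
  defines "P \<equiv> joint_dist pq p k1 k2 V"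
    and "Wk \<equiv> (\<lambda>(q, s, x1, x2, y). wk (snd (snd s)))" and "Yk \<equiv> (\<lambda>(q, s, x1, x2, y). yk y)"
  assumes finP: "finite (set_pmf P)"
begin

text \<open>After averaging over the code, the rival codeword has law \<open>k1 q a'\<close>, which
  depends on the true data only through \<open>z = (x2, b, w, q)\<close>. This is the situation of
  \<open>threshold_union_bound\<close>.\<close>

lemma wrong_source1_bound:
  "(\<integral>\<^sup>+(a, b, s). (\<Sum>a'\<in>{a'\<in>A. a' \<noteq> a \<and> f a' = f a}. \<integral>\<^sup>+(cq, c1, c2). \<integral>\<^sup>+y.
      of_bool (T < source1_ratio P Wk Yk (cq (f a)) a' b (wk s) (c1 a') (c2 b) (yk y))
      \<partial>V (c1 a) (c2 b) \<partial>random_code pq k1 k2 f g A B) \<partial>p) \<le> ennreal (1 / T)"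
proof -
  have "(\<integral>\<^sup>+(a, b, s). (\<Sum>a'\<in>{a'\<in>A. a' \<noteq> a \<and> f a' = f a}. \<integral>\<^sup>+(cq, c1, c2). \<integral>\<^sup>+y.
      of_bool (T < source1_ratio P Wk Yk (cq (f a)) a' b (wk s) (c1 a') (c2 b) (yk y))
      \<partial>V (c1 a) (c2 b) \<partial>random_code pq k1 k2 f g A B) \<partial>p)
    \<le> (\<integral>\<^sup>+(a, b, s). (\<Sum>a'\<in>A. \<integral>\<^sup>+q. \<integral>\<^sup>+x1. \<integral>\<^sup>+x2. \<integral>\<^sup>+y. \<integral>\<^sup>+r.
      of_bool (T < source1_ratio P Wk Yk q a' b (wk s) r x2 (yk y))
      \<partial>k1 q a' \<partial>V x1 x2 \<partial>k2 q b \<partial>k1 q a \<partial>pq) \<partial>p)"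
  proof (intro nn_integral_mono_AE AE_pmfI, clarify)
    fix a b s assume "(a, b, s) \<in> set_pmf p"
    from supp[OF this] have ab: "a \<in> A" "b \<in> B" "f a = g b" by auto
    show "(\<Sum>a'\<in>{a'\<in>A. a' \<noteq> a \<and> f a' = f a}. \<integral>\<^sup>+(cq, c1, c2). \<integral>\<^sup>+y.
      of_bool (T < source1_ratio P Wk Yk (cq (f a)) a' b (wk s) (c1 a') (c2 b) (yk y))
      \<partial>V (c1 a) (c2 b) \<partial>random_code pq k1 k2 f g A B)
    \<le> (\<Sum>a'\<in>A. \<integral>\<^sup>+q. \<integral>\<^sup>+x1. \<integral>\<^sup>+x2. \<integral>\<^sup>+y. \<integral>\<^sup>+r.
      of_bool (T < source1_ratio P Wk Yk q a' b (wk s) r x2 (yk y))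
      \<partial>k1 q a' \<partial>V x1 x2 \<partial>k2 q b \<partial>k1 q a \<partial>pq)"
      \<comment> \<open>The restrictions on \<open>a'\<close> give the independence and are used
        first; afterwards the sum of nonnegative terms is enlarged to all of
        \<open>A\<close>.\<close>
      apply (rule order_trans[OF eq_refl sum_mono2])
         apply (rule sum.cong[OF refl])
         apply (subst random_code_marginal_other_a[where f = f and g = g, OF fin ab, where F = "\<lambda>q x1 x2 r. \<integral>\<^sup>+y.
              of_bool (T < source1_ratio P Wk Yk q _ b (wk s) r x2 (yk y)) \<partial>V x1 x2"])
            apply simp_all[3]
         apply (subst nn_integral_pmf_commute[where N = "V _ _"], rule refl)
      using fin by auto
  qed
  also have "\<dots> = (\<integral>\<^sup>+v. (\<Sum>a'\<in>A. \<integral>\<^sup>+r.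
      of_bool (T < source1_ratio P Wk Yk (vQ v) a' (vS2 v) (Wk v) r (vX2 v) (Yk v)) \<partial>k1 (vQ v) a') \<partial>P)"
    unfolding split_def
    by (simp add: P_def nn_integral_joint_dist vQ_def vS2_def vX2_def Wk_def Yk_def nn_integral_sum case_prod_beta)
  also have "\<dots> \<le> ennreal (1 / T)"
    unfolding source1_ratio_def
    using threshold_union_bound[OF finP fin(1) T, where \<kappa> = "\<lambda>z. k1 (snd (snd (snd z)))"
        and \<beta> = "\<lambda>z. (fst (snd z), fst (snd (snd z)))" and \<xi> = "\<lambda>z a r. r"
        and A = vS1 and B = "\<lambda>v. (vS2 v, Wk v)" and X = vX1 and Y = Yk
        and Z = "\<lambda>v. (vX2 v, vS2 v, Wk v, vQ v)"]
    by simp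
  finally show ?thesis .
qed

lemma wrong_source2_bound:
  "(\<integral>\<^sup>+(a, b, s). (\<Sum>b'\<in>{b'\<in>B. b' \<noteq> b \<and> g b' = f a}. \<integral>\<^sup>+(cq, c1, c2). \<integral>\<^sup>+y.
      of_bool (T < source2_ratio P Wk Yk (cq (f a)) a b' (wk s) (c1 a) (c2 b') (yk y))
      \<partial>V (c1 a) (c2 b) \<partial>random_code pq k1 k2 f g A B) \<partial>p) \<le> ennreal (1 / T)"
proof -
  have "(\<integral>\<^sup>+(a, b, s). (\<Sum>b'\<in>{b'\<in>B. b' \<noteq> b \<and> g b' = f a}. \<integral>\<^sup>+(cq, c1, c2). \<integral>\<^sup>+y.
      of_bool (T < source2_ratio P Wk Yk (cq (f a)) a b' (wk s) (c1 a) (c2 b') (yk y))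
      \<partial>V (c1 a) (c2 b) \<partial>random_code pq k1 k2 f g A B) \<partial>p)
    \<le> (\<integral>\<^sup>+(a, b, s). (\<Sum>b'\<in>B. \<integral>\<^sup>+q. \<integral>\<^sup>+x1. \<integral>\<^sup>+x2. \<integral>\<^sup>+y. \<integral>\<^sup>+r.
      of_bool (T < source2_ratio P Wk Yk q a b' (wk s) x1 r (yk y))
      \<partial>k2 q b' \<partial>V x1 x2 \<partial>k2 q b \<partial>k1 q a \<partial>pq) \<partial>p)"
  proof (intro nn_integral_mono_AE AE_pmfI, clarify)
    fix a b s assume "(a, b, s) \<in> set_pmf p"
    from supp[OF this] have ab: "a \<in> A" "b \<in> B" "f a = g b" by auto
    show "(\<Sum>b'\<in>{b'\<in>B. b' \<noteq> b \<and> g b' = f a}. \<integral>\<^sup>+(cq, c1, c2). \<integral>\<^sup>+y.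
      of_bool (T < source2_ratio P Wk Yk (cq (f a)) a b' (wk s) (c1 a) (c2 b') (yk y))
      \<partial>V (c1 a) (c2 b) \<partial>random_code pq k1 k2 f g A B)
    \<le> (\<Sum>b'\<in>B. \<integral>\<^sup>+q. \<integral>\<^sup>+x1. \<integral>\<^sup>+x2. \<integral>\<^sup>+y. \<integral>\<^sup>+r.
      of_bool (T < source2_ratio P Wk Yk q a b' (wk s) x1 r (yk y))
      \<partial>k2 q b' \<partial>V x1 x2 \<partial>k2 q b \<partial>k1 q a \<partial>pq)"
      apply (rule order_trans[OF eq_refl sum_mono2])
         apply (rule sum.cong[OF refl])
         apply (subst random_code_marginal_other_b[where f = f and g = g, OF fin ab, where F = "\<lambda>q x1 x2 r. \<integral>\<^sup>+y.
              of_bool (T < source2_ratio P Wk Yk q a _ (wk s) x1 r (yk y)) \<partial>V x1 x2"])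
            apply simp_all[3]
         apply (subst nn_integral_pmf_commute[where N = "V _ _"], rule refl)
      using fin by auto
  qed
  also have "\<dots> = (\<integral>\<^sup>+v. (\<Sum>b'\<in>B. \<integral>\<^sup>+r.
      of_bool (T < source2_ratio P Wk Yk (vQ v) (vS1 v) b' (Wk v) (vX1 v) r (Yk v)) \<partial>k2 (vQ v) b') \<partial>P)"
    unfolding split_def
    by (simp add: P_def nn_integral_joint_dist vQ_def vS1_def vX1_def Wk_def Yk_def nn_integral_sum case_prod_beta)
  also have "\<dots> \<le> ennreal (1 / T)"
    unfolding source2_ratio_def
    using threshold_union_bound[OF finP fin(2) T, where \<kappa> = "\<lambda>z. k2 (snd (snd (snd z)))"
        and \<beta> = "\<lambda>z. (fst (snd z), fst (snd (snd z)))" and \<xi> = "\<lambda>z a r. r"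
        and A = vS2 and B = "\<lambda>v. (vS1 v, Wk v)" and X = vX2 and Y = Yk
        and Z = "\<lambda>v. (vX1 v, vS1 v, Wk v, vQ v)"]
    by simp
  finally show ?thesis .
qed

text \<open>Both rival codewords are drawn given the true time-sharing value, so the conditioning
  variable is \<open>z = (u, w, q)\<close> and the rival law is a product of the two kernels at
  \<open>q\<close>.\<close>

lemma wrong_pair_same_common_bound:
  "(\<integral>\<^sup>+(a, b, s). (\<Sum>v\<in>{a'\<in>A. a' \<noteq> a \<and> f a' = f a} \<times> {b'\<in>B. b' \<noteq> b \<and> g b' = f a}.
      \<integral>\<^sup>+(cq, c1, c2). \<integral>\<^sup>+y.
      of_bool (T < pair_ratio_given_common P f Wk Yk (f a) (cq (f a)) (fst v) (snd v) (wk s) (c1 (fst v)) (c2 (snd v)) (yk y))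
      \<partial>V (c1 a) (c2 b) \<partial>random_code pq k1 k2 f g A B) \<partial>p) \<le> ennreal (1 / T)"
proof -
  have "(\<integral>\<^sup>+(a, b, s). (\<Sum>v\<in>{a'\<in>A. a' \<noteq> a \<and> f a' = f a} \<times> {b'\<in>B. b' \<noteq> b \<and> g b' = f a}.
      \<integral>\<^sup>+(cq, c1, c2). \<integral>\<^sup>+y.
      of_bool (T < pair_ratio_given_common P f Wk Yk (f a) (cq (f a)) (fst v) (snd v) (wk s) (c1 (fst v)) (c2 (snd v)) (yk y))
      \<partial>V (c1 a) (c2 b) \<partial>random_code pq k1 k2 f g A B) \<partial>p)
    \<le> (\<integral>\<^sup>+(a, b, s). (\<Sum>v\<in>A \<times> B. \<integral>\<^sup>+q. \<integral>\<^sup>+x1. \<integral>\<^sup>+x2. \<integral>\<^sup>+y. \<integral>\<^sup>+r.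
      of_bool (T < pair_ratio_given_common P f Wk Yk (f a) q (fst v) (snd v) (wk s) (fst r) (snd r) (yk y))
      \<partial>pair_pmf (k1 q (fst v)) (k2 q (snd v)) \<partial>V x1 x2 \<partial>k2 q b \<partial>k1 q a \<partial>pq) \<partial>p)"
  proof (intro nn_integral_mono_AE AE_pmfI, clarify)
    fix a b s assume "(a, b, s) \<in> set_pmf p"
    from supp[OF this] have ab: "a \<in> A" "b \<in> B" "f a = g b" by auto
    show "(\<Sum>v\<in>{a'\<in>A. a' \<noteq> a \<and> f a' = f a} \<times> {b'\<in>B. b' \<noteq> b \<and> g b' = f a}.
      \<integral>\<^sup>+(cq, c1, c2). \<integral>\<^sup>+y.
      of_bool (T < pair_ratio_given_common P f Wk Yk (f a) (cq (f a)) (fst v) (snd v) (wk s) (c1 (fst v)) (c2 (snd v)) (yk y))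
      \<partial>V (c1 a) (c2 b) \<partial>random_code pq k1 k2 f g A B)
    \<le> (\<Sum>v\<in>A \<times> B. \<integral>\<^sup>+q. \<integral>\<^sup>+x1. \<integral>\<^sup>+x2. \<integral>\<^sup>+y. \<integral>\<^sup>+r.
      of_bool (T < pair_ratio_given_common P f Wk Yk (f a) q (fst v) (snd v) (wk s) (fst r) (snd r) (yk y))
      \<partial>pair_pmf (k1 q (fst v)) (k2 q (snd v)) \<partial>V x1 x2 \<partial>k2 q b \<partial>k1 q a \<partial>pq)"
      apply (rule order_trans[OF eq_refl sum_mono2])
         apply (rule sum.cong[OF refl])
         apply (subst random_code_marginal_other_pair[where f = f and g = g, OF fin ab, where F = "\<lambda>q x1 x2 r r'. \<integral>\<^sup>+y.
              of_bool (T < pair_ratio_given_common P f Wk Yk (f a) q _ _ (wk s) r r' (yk y)) \<partial>V x1 x2"])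
            apply auto[6]
         apply (subst nn_integral_pmf_commute[where N = "V _ _"], rule refl)
      using fin by auto
  qed
  also have "\<dots> = (\<integral>\<^sup>+v. (\<Sum>v'\<in>A \<times> B. \<integral>\<^sup>+r.
      of_bool (T < pair_ratio_given_common P f Wk Yk (f (vS1 v)) (vQ v) (fst v') (snd v') (Wk v) (fst r) (snd r) (Yk v))
      \<partial>pair_pmf (k1 (vQ v) (fst v')) (k2 (vQ v) (snd v'))) \<partial>P)"
    unfolding split_def
    by (simp add: P_def nn_integral_joint_dist vQ_def vS1_def Wk_def Yk_def nn_integral_sum case_prod_beta)
  also have "\<dots> \<le> ennreal (1 / T)"
    unfolding pair_ratio_given_common_def
    using threshold_union_bound[OF finP finite_cartesian_product[OF fin] T,
        where \<kappa> = "\<lambda>z v. pair_pmf (k1 (snd (snd z)) (fst v)) (k2 (snd (snd z)) (snd v))"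
        and \<beta> = "\<lambda>z. (fst z, fst (snd z))" and \<xi> = "\<lambda>z a r. r"
        and A = "\<lambda>v. (vS1 v, vS2 v)" and B = "\<lambda>v. (f (vS1 v), Wk v)" and X = "\<lambda>v. (vX1 v, vX2 v)"
        and Y = Yk and Z = "\<lambda>v. (f (vS1 v), Wk v, vQ v)"]
    by simp
  finally show ?thesis .
qed

text \<open>The rival codewords come with a fresh time-sharing value and are independent of
  everything received except through the choice of candidate; the conditioning variable is the side
  information alone.\<close>

lemma wrong_common_bound:
  "(\<integral>\<^sup>+(a, b, s). (\<Sum>v\<in>{v\<in>A \<times> B. f (fst v) = g (snd v) \<and> f (fst v) \<noteq> f a}.
      \<integral>\<^sup>+(cq, c1, c2). \<integral>\<^sup>+y.
      of_bool (T < pair_ratio P Wk Yk (fst v) (snd v) (wk s) (c1 (fst v)) (c2 (snd v)) (yk y))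
      \<partial>V (c1 a) (c2 b) \<partial>random_code pq k1 k2 f g A B) \<partial>p) \<le> ennreal (1 / T)"
proof -
  define \<kappa> where "\<kappa> v = bind_pmf pq (\<lambda>q'. pair_pmf (k1 q' (fst v)) (k2 q' (snd v)))" for v
  have "(\<integral>\<^sup>+(a, b, s). (\<Sum>v\<in>{v\<in>A \<times> B. f (fst v) = g (snd v) \<and> f (fst v) \<noteq> f a}.
      \<integral>\<^sup>+(cq, c1, c2). \<integral>\<^sup>+y.
      of_bool (T < pair_ratio P Wk Yk (fst v) (snd v) (wk s) (c1 (fst v)) (c2 (snd v)) (yk y))
      \<partial>V (c1 a) (c2 b) \<partial>random_code pq k1 k2 f g A B) \<partial>p)
    \<le> (\<integral>\<^sup>+(a, b, s). (\<Sum>v\<in>A \<times> B. \<integral>\<^sup>+q. \<integral>\<^sup>+x1. \<integral>\<^sup>+x2. \<integral>\<^sup>+y. \<integral>\<^sup>+r.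
      of_bool (T < pair_ratio P Wk Yk (fst v) (snd v) (wk s) (fst r) (snd r) (yk y))
      \<partial>\<kappa> v \<partial>V x1 x2 \<partial>k2 q b \<partial>k1 q a \<partial>pq) \<partial>p)"
  proof (intro nn_integral_mono_AE AE_pmfI, clarify)
    fix a b s assume "(a, b, s) \<in> set_pmf p"
    from supp[OF this] have ab: "a \<in> A" "b \<in> B" "f a = g b" by auto
    show "(\<Sum>v\<in>{v\<in>A \<times> B. f (fst v) = g (snd v) \<and> f (fst v) \<noteq> f a}.
      \<integral>\<^sup>+(cq, c1, c2). \<integral>\<^sup>+y.
      of_bool (T < pair_ratio P Wk Yk (fst v) (snd v) (wk s) (c1 (fst v)) (c2 (snd v)) (yk y))
      \<partial>V (c1 a) (c2 b) \<partial>random_code pq k1 k2 f g A B)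
    \<le> (\<Sum>v\<in>A \<times> B. \<integral>\<^sup>+q. \<integral>\<^sup>+x1. \<integral>\<^sup>+x2. \<integral>\<^sup>+y. \<integral>\<^sup>+r.
      of_bool (T < pair_ratio P Wk Yk (fst v) (snd v) (wk s) (fst r) (snd r) (yk y))
      \<partial>\<kappa> v \<partial>V x1 x2 \<partial>k2 q b \<partial>k1 q a \<partial>pq)"
      apply (rule order_trans[OF eq_refl sum_mono2])
         apply (rule sum.cong[OF refl])
         apply (subst random_code_marginal_other_common[where f = f and g = g, OF fin ab, where F = "\<lambda>q x1 x2 r r'. \<integral>\<^sup>+y.
              of_bool (T < pair_ratio P Wk Yk _ _ (wk s) r r' (yk y)) \<partial>V x1 x2"])
            apply auto[4]
         apply (subst \<kappa>_def[symmetric])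
         apply (subst nn_integral_pmf_commute[where N = "V _ _"], rule refl)
      using fin by auto
  qed
  also have "\<dots> = (\<integral>\<^sup>+v. (\<Sum>v'\<in>A \<times> B. \<integral>\<^sup>+r.
      of_bool (T < pair_ratio P Wk Yk (fst v') (snd v') (Wk v) (fst r) (snd r) (Yk v)) \<partial>\<kappa> v') \<partial>P)"
    unfolding split_def
    by (simp add: P_def nn_integral_joint_dist vQ_def vS1_def Wk_def Yk_def nn_integral_sum case_prod_beta)
  also have "\<dots> \<le> ennreal (1 / T)"
    unfolding pair_ratio_def
    using threshold_union_bound[OF finP finite_cartesian_product[OF fin] T,
        where \<kappa> = "\<lambda>z. \<kappa>" and \<beta> = "\<lambda>z. z" and \<xi> = "\<lambda>z a r. r"
        and A = "\<lambda>v. (vS1 v, vS2 v)" and B = Wk and X = "\<lambda>v. (vX1 v, vX2 v)"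
        and Y = Yk and Z = Wk]
    by simp
  finally show ?thesis .
qed

text \<open>The first term is the probability that the true pair fails a test, the second collects
  \<open>1 / T\<close> for each of the four classes of wrong candidates.\<close>

lemma random_code_average_error:
  "(\<integral>\<^sup>+(cq, c1, c2). \<integral>\<^sup>+(a, b, s). \<integral>\<^sup>+y.
      of_bool (decode T P f g Wk Yk A B cq c1 c2 (yk y) (wk s) \<noteq> (a, b))
      \<partial>V (c1 a) (c2 b) \<partial>p \<partial>random_code pq k1 k2 f g A B)
   \<le> (\<integral>\<^sup>+v. of_bool (\<not> accepts T P f g Wk Yk (vQ v) (vS1 v) (vS2 v) (Wk v) (vX1 v) (vX2 v) (Yk v)) \<partial>P)
      + 4 * ennreal (1 / T)" (is "?lhs \<le> ?R0 + _")
proof -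
  let ?C = "random_code pq k1 k2 f g A B"
  define E0 where "E0 = (\<lambda>(a, b, s). \<integral>\<^sup>+(cq, c1, c2). \<integral>\<^sup>+y.
    of_bool (\<not> accepts T P f g Wk Yk (cq (f a)) a b (wk s) (c1 a) (c2 b) (yk y)) \<partial>V (c1 a) (c2 b) \<partial>?C)"
  define E1 where "E1 = (\<lambda>(a, b, s). \<Sum>a'\<in>{a'\<in>A. a' \<noteq> a \<and> f a' = f a}. \<integral>\<^sup>+(cq, c1, c2). \<integral>\<^sup>+y.
    of_bool (T < source1_ratio P Wk Yk (cq (f a)) a' b (wk s) (c1 a') (c2 b) (yk y)) \<partial>V (c1 a) (c2 b) \<partial>?C)"
  define E2 where "E2 = (\<lambda>(a, b, s). \<Sum>b'\<in>{b'\<in>B. b' \<noteq> b \<and> g b' = f a}. \<integral>\<^sup>+(cq, c1, c2). \<integral>\<^sup>+y.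
    of_bool (T < source2_ratio P Wk Yk (cq (f a)) a b' (wk s) (c1 a) (c2 b') (yk y)) \<partial>V (c1 a) (c2 b) \<partial>?C)"
  define E3 where "E3 = (\<lambda>(a, b, s). \<Sum>v\<in>{a'\<in>A. a' \<noteq> a \<and> f a' = f a} \<times> {b'\<in>B. b' \<noteq> b \<and> g b' = f a}.
    \<integral>\<^sup>+(cq, c1, c2). \<integral>\<^sup>+y.
    of_bool (T < pair_ratio_given_common P f Wk Yk (f a) (cq (f a)) (fst v) (snd v) (wk s) (c1 (fst v)) (c2 (snd v)) (yk y))
    \<partial>V (c1 a) (c2 b) \<partial>?C)"
  define E4 where "E4 = (\<lambda>(a, b, s). \<Sum>v\<in>{v\<in>A \<times> B. f (fst v) = g (snd v) \<and> f (fst v) \<noteq> f a}.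
    \<integral>\<^sup>+(cq, c1, c2). \<integral>\<^sup>+y.
    of_bool (T < pair_ratio P Wk Yk (fst v) (snd v) (wk s) (c1 (fst v)) (c2 (snd v)) (yk y))
    \<partial>V (c1 a) (c2 b) \<partial>?C)"
  have "?lhs = (\<integral>\<^sup>+(a, b, s). \<integral>\<^sup>+(cq, c1, c2). \<integral>\<^sup>+y.
      of_bool (decode T P f g Wk Yk A B cq c1 c2 (yk y) (wk s) \<noteq> (a, b)) \<partial>V (c1 a) (c2 b) \<partial>?C \<partial>p)"
    unfolding split_def by (rule nn_integral_pmf_commute)
  also have "\<dots> \<le> (\<integral>\<^sup>+s. E0 s + E1 s + E2 s + E3 s + E4 s \<partial>p)"
  proof (intro nn_integral_mono_AE AE_pmfI)
    fix s' assume s': "s' \<in> set_pmf p"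
    obtain a b s where s: "s' = (a, b, s)" by (cases s')
    from supp[OF s'] have ab: "a \<in> A" "b \<in> B" "f a = g b" by (auto simp: s)
    have "(\<integral>\<^sup>+(cq, c1, c2). \<integral>\<^sup>+y.
      of_bool (decode T P f g Wk Yk A B cq c1 c2 (yk y) (wk s) \<noteq> (a, b)) \<partial>V (c1 a) (c2 b) \<partial>?C)
      \<le> E0 (a, b, s) + E1 (a, b, s) + E2 (a, b, s) + E3 (a, b, s) + E4 (a, b, s)"
      unfolding E0_def E1_def E2_def E3_def E4_def prod.case split_def
      by (simp add: nn_integral_sum[symmetric] nn_integral_add[symmetric] del: nn_integral_sum)
        (intro nn_integral_mono decode_error_cases[where f = f and g = g, OF fin ab])
    then show "(case s' of (a, b, s) \<Rightarrow> \<integral>\<^sup>+(cq, c1, c2). \<integral>\<^sup>+y.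
      of_bool (decode T P f g Wk Yk A B cq c1 c2 (yk y) (wk s) \<noteq> (a, b)) \<partial>V (c1 a) (c2 b) \<partial>?C)
      \<le> E0 s' + E1 s' + E2 s' + E3 s' + E4 s'"
      by (simp add: s)
  qed
  also have "\<dots> = (\<integral>\<^sup>+s. E0 s \<partial>p) + (\<integral>\<^sup>+s. E1 s \<partial>p) + (\<integral>\<^sup>+s. E2 s \<partial>p) + (\<integral>\<^sup>+s. E3 s \<partial>p) + (\<integral>\<^sup>+s. E4 s \<partial>p)"
    by (simp add: nn_integral_add)
  \<comment> \<open>For a fixed source outcome the true codewords and the output have exactly the
    conditional law prescribed by \<open>joint_dist\<close>.\<close>
  also have "(\<integral>\<^sup>+s. E0 s \<partial>p) = ?R0"
  proof -
    have "E0 s = (\<integral>\<^sup>+q. \<integral>\<^sup>+x1. \<integral>\<^sup>+x2. \<integral>\<^sup>+y.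
      of_bool (\<not> accepts T P f g Wk Yk q (fst s) (fst (snd s)) (wk (snd (snd s))) x1 x2 (yk y))
      \<partial>V x1 x2 \<partial>k2 q (fst (snd s)) \<partial>k1 q (fst s) \<partial>pq)" if "s \<in> set_pmf p" for s
      using random_code_marginal[OF fin, where f = f and g = g and a = "fst s" and b = "fst (snd s)" and pq = pq
          and ?k1.0 = k1 and ?k2.0 = k2 and F = "\<lambda>q x1 x2. \<integral>\<^sup>+y. of_bool (\<not> accepts T P f g Wk Yk q (fst s)
            (fst (snd s)) (wk (snd (snd s))) x1 x2 (yk y)) \<partial>V x1 x2"] supp[OF that]
      by (simp add: E0_def split_def)
    then have "(\<integral>\<^sup>+s. E0 s \<partial>p) = (\<integral>\<^sup>+s. \<integral>\<^sup>+q. \<integral>\<^sup>+x1. \<integral>\<^sup>+x2. \<integral>\<^sup>+y.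
      of_bool (\<not> accepts T P f g Wk Yk q (fst s) (fst (snd s)) (wk (snd (snd s))) x1 x2 (yk y))
      \<partial>V x1 x2 \<partial>k2 q (fst (snd s)) \<partial>k1 q (fst s) \<partial>pq \<partial>p)"
      by (intro nn_integral_cong_AE AE_pmfI)
    also have "\<dots> = ?R0"
      by (simp add: P_def nn_integral_joint_dist vQ_def vS1_def vS2_def vX1_def vX2_def Wk_def Yk_def split_def)
    finally show ?thesis .
  qed
  also have "?R0 + (\<integral>\<^sup>+s. E1 s \<partial>p) + (\<integral>\<^sup>+s. E2 s \<partial>p) + (\<integral>\<^sup>+s. E3 s \<partial>p) + (\<integral>\<^sup>+s. E4 s \<partial>p)
      \<le> ?R0 + ennreal (1 / T) + ennreal (1 / T) + ennreal (1 / T) + ennreal (1 / T)"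
    unfolding E1_def E2_def E3_def E4_def
    by (intro add_mono order_refl wrong_source1_bound wrong_source2_bound wrong_pair_same_common_bound wrong_common_bound)
  also have "\<dots> = ?R0 + 4 * ennreal (1 / T)"
  proof -
    have "(4 :: ennreal) = 1 + 1 + 1 + 1" by simp
    then show ?thesis by (simp only: distrib_right mult_1 add.assoc)
  qed
  finally show ?thesis .
qed

end

section \<open>From the average to a single code\<close>

lemma ex_less_of_nn_integral_less:
  fixes c :: ennreal
  assumes "(\<integral>\<^sup>+x. F x \<partial>measure_pmf M) < c"
  shows "\<exists>x. F x < c"
proof (rule ccontr)
  assume "\<not> ?thesis"
  then have "(\<integral>\<^sup>+x. c \<partial>measure_pmf M) \<le> (\<integral>\<^sup>+x. F x \<partial>measure_pmf M)"
    by (intro nn_integral_mono) (auto simp: not_less)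
  with assms show False by simp
qed

definition reject_prob where
  "reject_prob T P f g Wk Yk = measure_pmf.prob P
     {v. \<not> accepts T P f g Wk Yk (vQ v) (vS1 v) (vS2 v) (Wk v) (vX1 v) (vX2 v) (Yk v)}"

lemma reject_prob_nonneg: "0 \<le> reject_prob T P f g Wk Yk"
  by (simp add: reject_prob_def)

text \<open>Both receivers are averaged over the same random code and their errors are added, so one
  code serves both. The term \<open>8 / T\<close> comes from two receivers with four classes of
  wrong candidates each.\<close>

lemma one_shot_code_exists:
  fixes p :: "('a \<times> 'b \<times> 'w1 \<times> 'w2) pmf" and V :: "'x1 \<Rightarrow> 'x2 \<Rightarrow> ('y1 \<times> 'y2) pmf"
    and pq :: "'q pmf" and k1 :: "'q \<Rightarrow> 'a \<Rightarrow> 'x1 pmf" and k2 :: "'q \<Rightarrow> 'b \<Rightarrow> 'x2 pmf" and f :: "'a \<Rightarrow> 'u"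
  defines "P \<equiv> joint_dist pq p k1 k2 V"
  assumes common: "common_fn p f g" and finP: "finite (set_pmf P)" and finp: "finite (set_pmf p)" and T: "0 < T"
    and err: "reject_prob T P f g vW1 vY1 + reject_prob T P f g vW2 vY2 + 8 / T < \<epsilon>"
  obtains enc1 enc2 dec1 dec2 where
    "(\<integral>\<^sup>+(a, b, w1, w2). \<integral>\<^sup>+(y1, y2). of_bool (dec1 y1 w1 \<noteq> (a, b) \<or> dec2 y2 w2 \<noteq> (a, b))
        \<partial>V (enc1 a) (enc2 b) \<partial>p) < ennreal \<epsilon>"
proof -
  \<comment> \<open>Codewords are drawn only for source values of positive probability. This keeps
    the codebooks finite even when the source values are words, that is, functions on the
    naturals.\<close>
  define A where "A = fst ` set_pmf p"
  define B where "B = (fst \<circ> snd) ` set_pmf p"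
  let ?C = "random_code pq k1 k2 f g A B"
  let ?dec1 = "\<lambda>cq c1 c2 y1 w1. decode T P f g vW1 vY1 A B cq c1 c2 y1 w1"
  let ?dec2 = "\<lambda>cq c1 c2 y2 w2. decode T P f g vW2 vY2 A B cq c1 c2 y2 w2"
  have fin: "finite A" "finite B" using finp by (auto simp: A_def B_def)
  have supp: "fst s \<in> A \<and> fst (snd s) \<in> B \<and> f (fst s) = g (fst (snd s))" if "s \<in> set_pmf p" for s
    using that common by (cases s) (force simp: A_def B_def common_fn_def)
  have v: "vW1 = (\<lambda>(q, s, x1, x2, y). fst (snd (snd s)))" "vW2 = (\<lambda>(q, s, x1, x2, y). snd (snd (snd s)))"
    "vY1 = (\<lambda>(q, s, x1, x2, y). fst y)" "vY2 = (\<lambda>(q, s, x1, x2, y). snd y)"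
    by (auto simp: vW1_def vW2_def vY1_def vY2_def fun_eq_iff)
  have rej: "(\<integral>\<^sup>+v. of_bool (\<not> accepts T P f g Wk Yk (vQ v) (vS1 v) (vS2 v) (Wk v) (vX1 v) (vX2 v) (Yk v)) \<partial>P)
      = ennreal (reject_prob T P f g Wk Yk)" for Wk :: "_ \<Rightarrow> 'w" and Yk :: "_ \<Rightarrow> 'y"
    unfolding reject_prob_def measure_pmf.emeasure_eq_measure[symmetric]
    by (subst nn_integral_indicator[symmetric], simp, rule nn_integral_cong, simp add: indicator_def)
  have 1: "(\<integral>\<^sup>+(cq, c1, c2). \<integral>\<^sup>+(a, b, w). \<integral>\<^sup>+y. of_bool (?dec1 cq c1 c2 (fst y) (fst w) \<noteq> (a, b))
      \<partial>V (c1 a) (c2 b) \<partial>p \<partial>?C) \<le> ennreal (reject_prob T P f g vW1 vY1) + 4 * ennreal (1 / T)"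
    using random_code_average_error[OF fin supp T finP[unfolded P_def], where yk = fst and wk = fst]
    by (simp only: v[symmetric] P_def[symmetric] rej)
  have 2: "(\<integral>\<^sup>+(cq, c1, c2). \<integral>\<^sup>+(a, b, w). \<integral>\<^sup>+y. of_bool (?dec2 cq c1 c2 (snd y) (snd w) \<noteq> (a, b))
      \<partial>V (c1 a) (c2 b) \<partial>p \<partial>?C) \<le> ennreal (reject_prob T P f g vW2 vY2) + 4 * ennreal (1 / T)"
    using random_code_average_error[OF fin supp T finP[unfolded P_def], where yk = snd and wk = snd]
    by (simp only: v[symmetric] P_def[symmetric] rej)
  have "(\<integral>\<^sup>+(cq, c1, c2). \<integral>\<^sup>+(a, b, w1, w2). \<integral>\<^sup>+(y1, y2).
        of_bool (?dec1 cq c1 c2 y1 w1 \<noteq> (a, b) \<or> ?dec2 cq c1 c2 y2 w2 \<noteq> (a, b)) \<partial>V (c1 a) (c2 b) \<partial>p \<partial>?C)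
    \<le> (\<integral>\<^sup>+(cq, c1, c2). \<integral>\<^sup>+(a, b, w). \<integral>\<^sup>+y. of_bool (?dec1 cq c1 c2 (fst y) (fst w) \<noteq> (a, b))
      \<partial>V (c1 a) (c2 b) \<partial>p \<partial>?C) +
      (\<integral>\<^sup>+(cq, c1, c2). \<integral>\<^sup>+(a, b, w). \<integral>\<^sup>+y. of_bool (?dec2 cq c1 c2 (snd y) (snd w) \<noteq> (a, b))
      \<partial>V (c1 a) (c2 b) \<partial>p \<partial>?C)"
    unfolding split_def
    by (simp add: nn_integral_add[symmetric]) (intro nn_integral_mono, simp)
  also have "\<dots> \<le> ennreal (reject_prob T P f g vW1 vY1) + 4 * ennreal (1 / T)
      + (ennreal (reject_prob T P f g vW2 vY2) + 4 * ennreal (1 / T))"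
    by (intro add_mono 1 2)
  also have "\<dots> = ennreal (reject_prob T P f g vW1 vY1 + reject_prob T P f g vW2 vY2 + 8 / T)"
  proof -
    have "4 * ennreal (1 / T) = ennreal (4 / T)"
      using T by (subst ennreal_numeral[symmetric], subst ennreal_mult[symmetric]) auto
    then show ?thesis
      using T by (simp add: ennreal_plus[symmetric] reject_prob_def del: ennreal_plus)
  qed
  also have "\<dots> < ennreal \<epsilon>"
  proof (rule ennreal_lessI[OF _ err])
    have "0 \<le> reject_prob T P f g vW1 vY1 + reject_prob T P f g vW2 vY2 + 8 / T"
      using T by (simp add: reject_prob_def)
    with err show "0 < \<epsilon>" by simp
  qed
  finally obtain c where "(case c of (cq, c1, c2) \<Rightarrow> \<integral>\<^sup>+(a, b, w1, w2). \<integral>\<^sup>+(y1, y2).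
        of_bool (?dec1 cq c1 c2 y1 w1 \<noteq> (a, b) \<or> ?dec2 cq c1 c2 y2 w2 \<noteq> (a, b)) \<partial>V (c1 a) (c2 b) \<partial>p) < ennreal \<epsilon>"
    using ex_less_of_nn_integral_less by blast
  then show ?thesis
    by (cases c) (auto intro: that)
qed

subsection \<open>I.i.d. sequences\<close>

text \<open>The function \<open>G\<close> has value 1 and a negative derivative at 0, hence
  \<open>G t < 1\<close> for some \<open>t > 0\<close>; Markov's inequality and independence bound
  the tail by \<open>G t ^ n\<close>. All smaller bases above 1 are included so that several tests
  can share one base.\<close>

lemma chernoff_product:
  fixes D :: "'o \<Rightarrow> real" and P :: "'o pmf"
  assumes fin: "finite (set_pmf P)" and pos: "\<And>v. v \<in> set_pmf P \<Longrightarrow> 0 < D v"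
    and drift: "0 < measure_pmf.expectation P (\<lambda>v. ln (D v))"
  obtains c where "1 < c"
    "\<And>c'. 1 < c' \<Longrightarrow> c' \<le> c \<Longrightarrow>
      (\<lambda>n. measure_pmf.prob (Pi_pmf {..<n} d (\<lambda>_. P)) {h. (\<Prod>i<n. D (h i)) \<le> c' ^ n}) \<longlonglongrightarrow> 0"
proof -
  \<comment> \<open>Half of the drift: the threshold then grows exponentially, and the derivative of
    \<open>G\<close> at 0 is still \<open>- l\<close>.\<close>
  define l where "l = measure_pmf.expectation P (\<lambda>v. ln (D v)) / 2"
  have "l > 0" using drift by (simp add: l_def)
  define G where "G t = measure_pmf.expectation P (\<lambda>v. exp (t * (l - ln (D v))))" for t
  have G: "G = (\<lambda>t. \<Sum>v\<in>set_pmf P. pmf P v * exp (t * (l - ln (D v))))"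
    using fin by (simp add: G_def fun_eq_iff integral_measure_pmf_real[where A = "set_pmf P"] mult.commute)
  have "(G has_real_derivative (\<Sum>v\<in>set_pmf P. pmf P v * (l - ln (D v)))) (at 0)"
    unfolding G by (auto intro!: derivative_eq_intros simp: mult.commute)
  also have "(\<Sum>v\<in>set_pmf P. pmf P v * (l - ln (D v))) = measure_pmf.expectation P (\<lambda>v. l - ln (D v))"
    using fin by (subst integral_measure_pmf_real[where A = "set_pmf P"]) (auto simp: mult.commute)
  also have "\<dots> = - l"
    using fin by (simp add: integrable_measure_pmf_finite l_def)
  finally have "(G has_real_derivative - l) (at 0)" .
  from DERIV_neg_dec_right[OF this] obtain t0 where t0: "t0 > 0" "\<And>h. 0 < h \<Longrightarrow> h < t0 \<Longrightarrow> G h < G 0"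
    using \<open>l > 0\<close> by auto
  define t where "t = t0 / 2"
  have t: "0 < t" "G t < 1"
    using t0(1) t0(2)[of t] by (auto simp: t_def G_def)
  have G0: "0 \<le> G t" by (simp add: G_def)
  show ?thesis
  proof
    show "1 < exp l" using \<open>l > 0\<close> by simp
  next
    fix c' :: real assume c': "1 < c'" "c' \<le> exp l"
    let ?p = "\<lambda>n. measure_pmf.prob (Pi_pmf {..<n} d (\<lambda>_. P)) {h. (\<Prod>i<n. D (h i)) \<le> c' ^ n}"
    have "?p n \<le> G t ^ n" for n
    proof -
      let ?M = "Pi_pmf {..<n} d (\<lambda>_. P)"
      have finM: "finite (set_pmf ?M)"
        using fin by (auto simp: set_Pi_pmf)
      have "?p n = measure_pmf.expectation ?M (indicator {h. (\<Prod>i<n. D (h i)) \<le> c' ^ n})"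
        by simp
      \<comment> \<open>On the tail event the product is at most \<open>exp l ^ n\<close>, so the
        right-hand integrand is at least 1; elsewhere it is nonnegative.\<close>
      also have "\<dots> \<le> measure_pmf.expectation ?M (\<lambda>h. \<Prod>i<n. exp (t * (l - ln (D (h i)))))"
      proof (intro integral_mono_AE AE_pmfI integrable_measure_pmf_finite finM)
        fix h assume "h \<in> set_pmf ?M"
        then have h: "0 < D (h i)" if "i < n" for i
          using that pos by (auto simp: set_Pi_pmf PiE_dflt_def)
        show "indicator {h. (\<Prod>i<n. D (h i)) \<le> c' ^ n} h \<le> (\<Prod>i<n. exp (t * (l - ln (D (h i)))))"
        proof (cases "(\<Prod>i<n. D (h i)) \<le> c' ^ n")
          case True
          have "(\<Prod>i<n. D (h i)) \<le> exp l ^ n"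
            using True c' power_mono[of c' "exp l" n] by linarith
          then have "ln (\<Prod>i<n. D (h i)) \<le> ln (exp l ^ n)"
            using h by (subst ln_le_cancel_iff) (auto intro!: prod_pos)
          moreover have "ln (\<Prod>i<n. D (h i)) = (\<Sum>i<n. ln (D (h i)))"
          proof (rule ln_prod)
            show "D (h i) \<noteq> 0" if "i \<in> {..<n}" for i
              using h[of i] that by simp
          qed simp
          ultimately have "(\<Sum>i<n. ln (D (h i))) \<le> n * l"
            by (simp add: ln_realpow)
          then have "0 \<le> t * (\<Sum>i<n. l - ln (D (h i)))"
            using t by (simp add: sum_subtractf)
          then have "1 \<le> exp (\<Sum>i<n. t * (l - ln (D (h i))))"
            by (simp add: sum_distrib_left)
          then show ?thesis using True by (simp add: exp_sum)
        qed (simp add: prod_nonneg)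
      qed
      also have "\<dots> = (\<Prod>i<n. G t)"
        unfolding G_def using fin
        by (subst expectation_prod_Pi_pmf) (auto intro: integrable_measure_pmf_finite)
      finally show ?thesis by simp
    qed
    moreover have "(\<lambda>n. G t ^ n) \<longlonglongrightarrow> 0"
      using t G0 by (intro LIMSEQ_realpow_zero)
    ultimately show "?p \<longlonglongrightarrow> 0"
      using tendsto_sandwich[of "\<lambda>_. 0" ?p sequentially "\<lambda>n. G t ^ n" 0]
      by (simp add: always_eventually)
  qed
qed

section \<open>The logarithmic drift of an information ratio\<close>

lemma ent_eq_expectation:
  assumes "finite (set_pmf P)"
  shows "ent P X = measure_pmf.expectation P (\<lambda>v. - log 2 (pmf (map_pmf X P) (X v)))"
proof -
  have "ent P X = measure_pmf.expectation (map_pmf X P) (\<lambda>x. - log 2 (pmf (map_pmf X P) x))"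
    unfolding ent_def pmf_entropy_def using assms
    by (subst integral_measure_pmf_real[where A = "set_pmf (map_pmf X P)"]) (auto simp: mult.commute)
  then show ?thesis by simp
qed

lemma pmf_map_pos: "v \<in> set_pmf P \<Longrightarrow> 0 < pmf (map_pmf X P) (X v)"
  by (simp add: pmf_positive)

lemma info_ratio_pos:
  "v \<in> set_pmf P \<Longrightarrow> 0 < info_ratio P A B X Y Z (A v) (B v) (X v) (Y v) (Z v)"
  using pmf_map_pos[of v P "\<lambda>w. (A w, B w)"] pmf_map_pos[of v P B] pmf_map_pos[of v P Z]
    pmf_map_pos[of v P "\<lambda>w. (X w, Y w, Z w)"] pmf_map_pos[of v P "\<lambda>w. (X w, Z w)"]
    pmf_map_pos[of v P "\<lambda>w. (Y w, Z w)"]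
  by (simp add: info_ratio_def)

text \<open>On the support all six probabilities are positive, so the logarithm splits; each summand
  averages to an entropy up to sign, and these add up to the two conditional quantities.\<close>

lemma expectation_log_info_ratio:
  assumes "finite (set_pmf P)"
  shows "measure_pmf.expectation P (\<lambda>v. log 2 (info_ratio P A B X Y Z (A v) (B v) (X v) (Y v) (Z v)))
       = cond_mi P X Y Z - cond_ent P A B"
proof -
  let ?l = "\<lambda>X v. log 2 (pmf (map_pmf X P) (X v))"
  have "log 2 (info_ratio P A B X Y Z (A v) (B v) (X v) (Y v) (Z v))
    = ?l (\<lambda>w. (A w, B w)) v - ?l B v + ?l (\<lambda>w. (X w, Y w, Z w)) v + ?l Z v
      - ?l (\<lambda>w. (X w, Z w)) v - ?l (\<lambda>w. (Y w, Z w)) v" if "v \<in> set_pmf P" for v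
    using pmf_map_pos[OF that, of "\<lambda>w. (A w, B w)"] pmf_map_pos[OF that, of B] pmf_map_pos[OF that, of Z]
    pmf_map_pos[OF that, of "\<lambda>w. (X w, Y w, Z w)"] pmf_map_pos[OF that, of "\<lambda>w. (X w, Z w)"]
    pmf_map_pos[OF that, of "\<lambda>w. (Y w, Z w)"]
    by (simp add: info_ratio_def log_mult log_divide)
  then have "measure_pmf.expectation P (\<lambda>v. log 2 (info_ratio P A B X Y Z (A v) (B v) (X v) (Y v) (Z v)))
    = measure_pmf.expectation P (\<lambda>v. ?l (\<lambda>w. (A w, B w)) v - ?l B v + ?l (\<lambda>w. (X w, Y w, Z w)) v + ?l Z v
      - ?l (\<lambda>w. (X w, Z w)) v - ?l (\<lambda>w. (Y w, Z w)) v)"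
    by (intro integral_cong_AE AE_pmfI) auto
  also have "\<dots> = cond_mi P X Y Z - cond_ent P A B"
    using assms by (simp add: cond_mi_def cond_ent_def ent_eq_expectation integrable_measure_pmf_finite)
  finally show ?thesis .
qed

lemma info_ratio_product_tail:
  fixes P :: "'o pmf"
  assumes fin: "finite (set_pmf P)" and "cond_ent P A B < cond_mi P X Y Z"
  obtains c where "1 < c"
    "\<And>c'. 1 < c' \<Longrightarrow> c' \<le> c \<Longrightarrow>
      (\<lambda>n. measure_pmf.prob (Pi_pmf {..<n} d (\<lambda>_. P))
         {h. (\<Prod>i<n. info_ratio P A B X Y Z (A (h i)) (B (h i)) (X (h i)) (Y (h i)) (Z (h i))) \<le> c' ^ n}) \<longlonglongrightarrow> 0"
proof -
  let ?D = "\<lambda>v. info_ratio P A B X Y Z (A v) (B v) (X v) (Y v) (Z v)"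
  have "0 < measure_pmf.expectation P (\<lambda>v. log 2 (?D v))"
    using assms by (simp add: expectation_log_info_ratio)
  then have drift: "0 < measure_pmf.expectation P (\<lambda>v. ln (?D v))"
    by (simp add: log_def zero_less_divide_iff)
  show thesis
    using chernoff_product[OF fin _ drift, where d = d, OF info_ratio_pos] that by blast
qed

section \<open>Blocks of letters as single letters over word alphabets\<close>

definition unzip2 :: "(nat \<Rightarrow> 'a \<times> 'b) \<Rightarrow> (nat \<Rightarrow> 'a) \<times> (nat \<Rightarrow> 'b)" where
  "unzip2 h = (\<lambda>i. fst (h i), \<lambda>i. snd (h i))"

definition unzip4 :: "(nat \<Rightarrow> 'a \<times> 'b \<times> 'c \<times> 'd) \<Rightarrow>
    (nat \<Rightarrow> 'a) \<times> (nat \<Rightarrow> 'b) \<times> (nat \<Rightarrow> 'c) \<times> (nat \<Rightarrow> 'd)" where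
  "unzip4 h = (\<lambda>i. fst (h i), \<lambda>i. fst (snd (h i)), \<lambda>i. fst (snd (snd (h i))), \<lambda>i. snd (snd (snd (h i))))"

text \<open>The result has the tuple shape of a single letter, so the projections \<open>vQ\<close>,
  \<open>vS1\<close> and so on apply to words too.\<close>

definition unzip_joint where
  "unzip_joint h = (\<lambda>i. vQ (h i), (\<lambda>i. vS1 (h i), \<lambda>i. vS2 (h i), \<lambda>i. vW1 (h i), \<lambda>i. vW2 (h i)),
     \<lambda>i. vX1 (h i), \<lambda>i. vX2 (h i), (\<lambda>i. vY1 (h i), \<lambda>i. vY2 (h i)))"

text \<open>Written as an instance of \<open>joint_dist\<close> over word alphabets, so that the
  one-shot result applies to blocks directly.\<close>

definition joint_dist_iid where
  "joint_dist_iid n pq p k1 k2 V =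
   joint_dist (Pi_pmf {..<n} undefined (\<lambda>_. pq)) (map_pmf unzip4 (Pi_pmf {..<n} undefined (\<lambda>_. p)))
     (\<lambda>q a. Pi_pmf {..<n} undefined (\<lambda>i. k1 (q i) (a i)))
     (\<lambda>q b. Pi_pmf {..<n} undefined (\<lambda>i. k2 (q i) (b i)))
     (\<lambda>x1 x2. map_pmf unzip2 (Pi_pmf {..<n} undefined (\<lambda>i. V (x1 i) (x2 i))))"

text \<open>Products commute with successive draws, by \<open>Pi_pmf_bind\<close>. Each of the five
  draws fills the positions outside \<open>{..<n}\<close> with its own \<open>undefined\<close>,
  hence the tuple as default.\<close>

lemma joint_dist_iid_eq:
  "joint_dist_iid n pq p k1 k2 V =
   map_pmf unzip_joint (Pi_pmf {..<n} (undefined, undefined, undefined, undefined, undefined)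
     (\<lambda>_. joint_dist pq p k1 k2 V))"
proof -
  have *: "Pi_pmf {..<n} d (\<lambda>i. bind_pmf (A i) (B i)) =
      bind_pmf (Pi_pmf {..<n} undefined A) (\<lambda>h. Pi_pmf {..<n} d (\<lambda>i. B i (h i)))" for d A B
    by (rule Pi_pmf_bind) simp_all
  show ?thesis
    unfolding joint_dist_iid_def joint_dist_def * Pi_pmf_return_pmf[OF finite_lessThan]
    unfolding map_bind_pmf bind_map_pmf map_return_pmf unzip4_def unzip2_def fst_conv snd_conv
    by (intro bind_pmf_cong refl arg_cong[where f = return_pmf])
      (auto simp: unzip_joint_def vQ_def vS1_def vS2_def vW1_def vW2_def vX1_def vX2_def
        vY1_def vY2_def fun_eq_iff set_Pi_pmf PiE_dflt_def split_def)
qed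

text \<open>On the support, \<open>F\<close> and the letterwise image under \<open>X\<close>
  separate the same sequences, so the event has the product probability of the letters.\<close>

lemma pmf_map_Pi_pmf:
  fixes n :: nat
  assumes h: "h \<in> set_pmf (Pi_pmf {..<n} d (\<lambda>_. P))"
    and iff: "\<And>h'. h' \<in> set_pmf (Pi_pmf {..<n} d (\<lambda>_. P)) \<Longrightarrow> F h' = F h \<longleftrightarrow> X \<circ> h' = X \<circ> h"
  shows "pmf (map_pmf F (Pi_pmf {..<n} d (\<lambda>_. P))) (F h) = (\<Prod>i<n. pmf (map_pmf X P) (X (h i)))"
proof -
  let ?M = "Pi_pmf {..<n} d (\<lambda>_. P)"
  have "pmf (map_pmf F ?M) (F h) = measure_pmf.prob ?M ((F -` {F h}) \<inter> set_pmf ?M)"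
    by (simp add: pmf_map measure_Int_set_pmf)
  also have "(F -` {F h}) \<inter> set_pmf ?M = ((\<lambda>h. X \<circ> h) -` {X \<circ> h}) \<inter> set_pmf ?M"
    using iff by auto
  also have "measure_pmf.prob ?M \<dots> = pmf (map_pmf (\<lambda>h. X \<circ> h) ?M) (X \<circ> h)"
    by (simp add: pmf_map measure_Int_set_pmf)
  also have "map_pmf (\<lambda>h. X \<circ> h) ?M = Pi_pmf {..<n} (X d) (\<lambda>_. map_pmf X P)"
    by (rule Pi_pmf_map[symmetric]) auto
  also have "pmf \<dots> (X \<circ> h) = (\<Prod>i<n. pmf (map_pmf X P) (X (h i)))"
    using h by (subst pmf_Pi') (auto simp: set_Pi_pmf PiE_dflt_def)
  finally show ?thesis .
qed

text \<open>The word variable \<open>X'\<close> carries the same information on the support as the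
  letters \<open>X\<close>. Only the induced partition matters for probabilities, so values outside
  the block may be stored differently.\<close>

definition lifts where
  "lifts M \<phi> X' X \<longleftrightarrow> (\<forall>h\<in>set_pmf M. \<forall>h'\<in>set_pmf M. X' (\<phi> h') = X' (\<phi> h) \<longleftrightarrow> X \<circ> h' = X \<circ> h)"

lemma lifts_Pair: "lifts M \<phi> X' X \<Longrightarrow> lifts M \<phi> Y' Y \<Longrightarrow> lifts M \<phi> (\<lambda>v. (X' v, Y' v)) (\<lambda>v. (X v, Y v))"
  unfolding lifts_def by (auto simp: fun_eq_iff)

lemma pmf_map_iid:
  fixes n :: nat
  assumes "lifts (Pi_pmf {..<n} d (\<lambda>_. P)) \<phi> X' X" "h \<in> set_pmf (Pi_pmf {..<n} d (\<lambda>_. P))"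
  shows "pmf (map_pmf X' (map_pmf \<phi> (Pi_pmf {..<n} d (\<lambda>_. P)))) (X' (\<phi> h)) = (\<Prod>i<n. pmf (map_pmf X P) (X (h i)))"
  using pmf_map_Pi_pmf[OF assms(2), of "\<lambda>h. X' (\<phi> h)" X] assms
  by (simp add: lifts_def map_pmf_comp)

lemma info_ratio_iid:
  fixes n :: nat
  assumes l: "lifts (Pi_pmf {..<n} d (\<lambda>_. P)) \<phi> A' A" "lifts (Pi_pmf {..<n} d (\<lambda>_. P)) \<phi> B' B"
    "lifts (Pi_pmf {..<n} d (\<lambda>_. P)) \<phi> X' X" "lifts (Pi_pmf {..<n} d (\<lambda>_. P)) \<phi> Y' Y"
    "lifts (Pi_pmf {..<n} d (\<lambda>_. P)) \<phi> Z' Z"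
    and h: "h \<in> set_pmf (Pi_pmf {..<n} d (\<lambda>_. P))"
  shows "info_ratio (map_pmf \<phi> (Pi_pmf {..<n} d (\<lambda>_. P))) A' B' X' Y' Z'
      (A' (\<phi> h)) (B' (\<phi> h)) (X' (\<phi> h)) (Y' (\<phi> h)) (Z' (\<phi> h))
    = (\<Prod>i<n. info_ratio P A B X Y Z (A (h i)) (B (h i)) (X (h i)) (Y (h i)) (Z (h i)))"
  unfolding info_ratio_def
  using pmf_map_iid[OF lifts_Pair[OF l(1,2)] h] pmf_map_iid[OF l(2) h]
    pmf_map_iid[OF lifts_Pair[OF l(3) lifts_Pair[OF l(4,5)]] h] pmf_map_iid[OF l(5) h]
    pmf_map_iid[OF lifts_Pair[OF l(3,5)] h] pmf_map_iid[OF lifts_Pair[OF l(4,5)] h]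
  by (simp add: prod.distrib prod_dividef)

text \<open>On the support each block ratio is the product of the letter ratios, so rejection is a
  union of four tail events, and each of them vanishes by its own inequality in
  \<open>receiver_conds\<close>.\<close>

lemma reject_prob_tendsto_0:
  fixes P :: "('q \<times> ('s1 \<times> 's2 \<times> 'w1 \<times> 'w2) \<times> 'x1 \<times> 'x2 \<times> ('y1 \<times> 'y2)) pmf"
    and f :: "'s1 \<Rightarrow> 'u" and g :: "'s2 \<Rightarrow> 'u" and d
  defines "M \<equiv> \<lambda>n. Pi_pmf {..<n} d (\<lambda>_. P)"
    and "fn \<equiv> \<lambda>n a i. if i < n then f (a i) else undefined"
    and "gn \<equiv> \<lambda>n a i. if i < n then g (a i) else undefined"
  assumes fin: "finite (set_pmf P)"
    and conds: "receiver_conds P vQ vS1 vS2 vX1 vX2 (\<lambda>w. f (vS1 w)) Wk Yk"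
    and common: "\<And>v. v \<in> set_pmf P \<Longrightarrow> f (vS1 v) = g (vS2 v)"
    and Wn: "\<And>h. Wn (unzip_joint h) = (\<lambda>i. Wk (h i))" and Yn: "\<And>h. Yn (unzip_joint h) = (\<lambda>i. Yk (h i))"
  obtains c where "1 < c" "\<And>c'. 1 < c' \<Longrightarrow> c' \<le> c \<Longrightarrow>
    (\<lambda>n. reject_prob (c' ^ n) (map_pmf unzip_joint (M n)) (fn n) (gn n) Wn Yn) \<longlonglongrightarrow> 0"
proof -
  let ?U = "\<lambda>v. f (vS1 v)"
  define tail where "tail D c n = measure_pmf.prob (M n) {h. (\<Prod>i<n. D (h i)) \<le> c ^ n}"
    for D :: "_ \<Rightarrow> real" and c :: real and n
  define D1 where "D1 v = source1_ratio P Wk Yk (vQ v) (vS1 v) (vS2 v) (Wk v) (vX1 v) (vX2 v) (Yk v)" for v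
  define D2 where "D2 v = source2_ratio P Wk Yk (vQ v) (vS1 v) (vS2 v) (Wk v) (vX1 v) (vX2 v) (Yk v)" for v
  define D3 where "D3 v = pair_ratio_given_common P f Wk Yk (f (vS1 v)) (vQ v) (vS1 v) (vS2 v) (Wk v) (vX1 v) (vX2 v) (Yk v)" for v
  define D4 where "D4 v = pair_ratio P Wk Yk (vS1 v) (vS2 v) (Wk v) (vX1 v) (vX2 v) (Yk v)" for v
  note conds = conds[unfolded receiver_conds_def]
  obtain c1 where c1: "1 < c1" "\<And>c. 1 < c \<Longrightarrow> c \<le> c1 \<Longrightarrow> tail D1 c \<longlonglongrightarrow> 0"
    using info_ratio_product_tail[OF fin conds[THEN conjunct1], where d = d]
    unfolding tail_def D1_def source1_ratio_def M_def by blast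
  obtain c2 where c2: "1 < c2" "\<And>c. 1 < c \<Longrightarrow> c \<le> c2 \<Longrightarrow> tail D2 c \<longlonglongrightarrow> 0"
    using info_ratio_product_tail[OF fin conds[THEN conjunct2, THEN conjunct1], where d = d]
    unfolding tail_def D2_def source2_ratio_def M_def by blast
  obtain c3 where c3: "1 < c3" "\<And>c. 1 < c \<Longrightarrow> c \<le> c3 \<Longrightarrow> tail D3 c \<longlonglongrightarrow> 0"
    using info_ratio_product_tail[OF fin conds[THEN conjunct2, THEN conjunct2, THEN conjunct1], where d = d]
    unfolding tail_def D3_def pair_ratio_given_common_def M_def by blast
  obtain c4 where c4: "1 < c4" "\<And>c. 1 < c \<Longrightarrow> c \<le> c4 \<Longrightarrow> tail D4 c \<longlonglongrightarrow> 0"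
    using info_ratio_product_tail[OF fin conds[THEN conjunct2, THEN conjunct2, THEN conjunct2], where d = d]
    unfolding tail_def D4_def pair_ratio_def M_def by blast
  have reject: "reject_prob (c ^ n) (map_pmf unzip_joint (M n)) (fn n) (gn n) Wn Yn
      \<le> tail D1 c n + tail D2 c n + tail D3 c n + tail D4 c n" for c n
  proof -
    let ?P = "map_pmf unzip_joint (M n)"
    have outside: "h i = d" if "h \<in> set_pmf (M n)" "\<not> i < n" for h i
      using that by (auto simp: M_def set_Pi_pmf PiE_dflt_def)
    have inside: "h i \<in> set_pmf P" if "h \<in> set_pmf (M n)" "i < n" for h i
      using that by (auto simp: M_def set_Pi_pmf PiE_dflt_def)
    have v: "vQ (unzip_joint h) = (\<lambda>i. vQ (h i))" "vS1 (unzip_joint h) = (\<lambda>i. vS1 (h i))"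
      "vS2 (unzip_joint h) = (\<lambda>i. vS2 (h i))" "vX1 (unzip_joint h) = (\<lambda>i. vX1 (h i))"
      "vX2 (unzip_joint h) = (\<lambda>i. vX2 (h i))" for h :: "nat \<Rightarrow> 'q \<times> ('s1 \<times> 's2 \<times> 'w1 \<times> 'w2) \<times> 'x1 \<times> 'x2 \<times> ('y1 \<times> 'y2)"
      by (simp_all add: unzip_joint_def vQ_def vS1_def vS2_def vX1_def vX2_def)
    have l: "lifts (M n) unzip_joint vQ vQ" "lifts (M n) unzip_joint vS1 vS1" "lifts (M n) unzip_joint vS2 vS2"
      "lifts (M n) unzip_joint vX1 vX1" "lifts (M n) unzip_joint vX2 vX2"
      "lifts (M n) unzip_joint Wn Wk" "lifts (M n) unzip_joint Yn Yk"
      unfolding lifts_def by (auto simp: v Wn Yn comp_def)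
    \<comment> \<open>Outside the block every sequence of the support equals \<open>d\<close>, so
      overwriting the common value there by \<open>undefined\<close> loses nothing.\<close>
    have lU: "lifts (M n) unzip_joint (\<lambda>v. fn n (vS1 v)) ?U"
      unfolding lifts_def v fn_def comp_def fun_eq_iff using outside by metis
    note lP = lifts_Pair
    have Mn: "Pi_pmf {..<n} d (\<lambda>_. P) = M n" by (simp add: M_def)
    note iid = info_ratio_iid[where d = d and P = P and n = n, unfolded Mn]
    have "accepts (c ^ n) ?P (fn n) (gn n) Wn Yn (vQ (unzip_joint h)) (vS1 (unzip_joint h))
       (vS2 (unzip_joint h)) (Wn (unzip_joint h)) (vX1 (unzip_joint h)) (vX2 (unzip_joint h)) (Yn (unzip_joint h))
      \<longleftrightarrow> c ^ n < (\<Prod>i<n. D1 (h i)) \<and> c ^ n < (\<Prod>i<n. D2 (h i)) \<and> c ^ n < (\<Prod>i<n. D3 (h i)) \<and> c ^ n < (\<Prod>i<n. D4 (h i))"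
      if h: "h \<in> set_pmf (M n)" for h
    proof -
      have "fn n (vS1 (unzip_joint h)) = gn n (vS2 (unzip_joint h))"
        using common[OF inside[OF h]] by (simp add: v fn_def gn_def fun_eq_iff)
      then show ?thesis
        unfolding accepts_def D1_def D2_def D3_def D4_def source1_ratio_def source2_ratio_def pair_ratio_given_common_def pair_ratio_def
        using iid[OF l(2) lP[OF l(3,6)] l(4) l(7) lP[OF l(5) lP[OF l(3) lP[OF l(6,1)]]] h]
          iid[OF l(3) lP[OF l(2,6)] l(5) l(7) lP[OF l(4) lP[OF l(2) lP[OF l(6,1)]]] h]
          iid[OF lP[OF l(2,3)] lP[OF lU l(6)] lP[OF l(4,5)] l(7) lP[OF lU lP[OF l(6,1)]] h]
          iid[OF lP[OF l(2,3)] l(6) lP[OF l(4,5)] l(7) l(6) h]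
        by simp
    qed
    then have "reject_prob (c ^ n) ?P (fn n) (gn n) Wn Yn = measure_pmf.prob (M n)
       ({h. (\<Prod>i<n. D1 (h i)) \<le> c ^ n} \<union> {h. (\<Prod>i<n. D2 (h i)) \<le> c ^ n} \<union>
        {h. (\<Prod>i<n. D3 (h i)) \<le> c ^ n} \<union> {h. (\<Prod>i<n. D4 (h i)) \<le> c ^ n})"
      unfolding reject_prob_def measure_map_pmf
      by (intro measure_pmf.finite_measure_eq_AE AE_pmfI) auto
    also have "\<dots> \<le> tail D1 c n + tail D2 c n + tail D3 c n + tail D4 c n"
      unfolding tail_def
      by (intro order_trans[OF measure_Un_le] add_mono order_refl) auto
    finally show ?thesis .
  qed
  show thesis
  proof (rule that)
    show "1 < min (min c1 c2) (min c3 c4)"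
      using c1 c2 c3 c4 by simp
    fix c assume c: "1 < c" "c \<le> min (min c1 c2) (min c3 c4)"
    have "(\<lambda>n. tail D1 c n + tail D2 c n + tail D3 c n + tail D4 c n) \<longlonglongrightarrow> 0 + 0 + 0 + 0"
      using c by (intro tendsto_add c1 c2 c3 c4) auto
    then have lim: "(\<lambda>n. tail D1 c n + tail D2 c n + tail D3 c n + tail D4 c n) \<longlonglongrightarrow> 0"
      by simp
    show "(\<lambda>n. reject_prob (c ^ n) (map_pmf unzip_joint (M n)) (fn n) (gn n) Wn Yn) \<longlonglongrightarrow> 0"
      by (rule tendsto_sandwich[OF _ _ tendsto_const lim])
        (simp_all add: reject always_eventually reject_prob_nonneg)
  qed
qed

section \<open>Achievability from the one-shot code on long blocks\<close>

lemma mac_error_prob_eq: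
  "ennreal (mac_error_prob p W m n enc1 enc2 dec1 dec2) =
   (\<integral>\<^sup>+(s1, s2, w1, w2). \<integral>\<^sup>+(y1, y2). of_bool
      ((\<exists>i<m. fst (dec1 y1 w1) i \<noteq> s1 i \<or> snd (dec1 y1 w1) i \<noteq> s2 i) \<or>
       (\<exists>i<m. fst (dec2 y2 w2) i \<noteq> s1 i \<or> snd (dec2 y2 w2) i \<noteq> s2 i))
      \<partial>map_pmf unzip2 (Pi_pmf {..<n} undefined (\<lambda>i. W (enc1 s1 i) (enc2 s2 i)))
      \<partial>map_pmf unzip4 (Pi_pmf {..<m} undefined (\<lambda>_. p)))"
  unfolding mac_error_prob_def Let_def measure_pmf.emeasure_eq_measure[symmetric]
  by (simp add: unzip2_def unzip4_def split_def indicator_def of_bool_def)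

text \<open>The type of words is infinite, but the support fixes all positions outside
  \<open>A\<close> to the default.\<close>

lemma finite_set_Pi_pmf:
  "finite A \<Longrightarrow> finite (set_pmf (Pi_pmf A d (p :: 'i \<Rightarrow> 'a::finite pmf)))"
  by (simp add: set_Pi_pmf finite_PiE_dflt)

theorem theorem4:
  fixes p :: "('s1::finite \<times> 's2::finite \<times> 'w1::finite \<times> 'w2::finite) pmf"
    and W :: "'x1::finite \<Rightarrow> 'x2::finite \<Rightarrow> ('y1::finite \<times> 'y2::finite) pmf"
    and f :: "'s1 \<Rightarrow> 'u" and g :: "'s2 \<Rightarrow> 'u"
    and pq :: "'q::finite pmf"
    and px1 :: "'q \<Rightarrow> 's1 \<Rightarrow> 'x1 pmf" and px2 :: "'q \<Rightarrow> 's2 \<Rightarrow> 'x2 pmf"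
  assumes gk: "gk_common_part p f g"
    and cond1: "receiver_conds (joint_dist pq p px1 px2 W) vQ vS1 vS2 vX1 vX2
                  (\<lambda>w. f (vS1 w)) vW1 vY1"
    and cond2: "receiver_conds (joint_dist pq p px1 px2 W) vQ vS1 vS2 vX1 vX2
                  (\<lambda>w. f (vS1 w)) vW2 vY2"
  shows "achievable_rate p W 1"
  unfolding achievable_rate_def
proof (intro allI impI)
  fix \<epsilon> :: real assume "0 < \<epsilon>"
  define P where "P = joint_dist pq p px1 px2 W"
  define Pn where "Pn n = joint_dist_iid n pq p px1 px2 W" for n
  \<comment> \<open>Off \<open>{..<n}\<close> the words hold \<open>undefined\<close> values, on which \<open>f\<close> and \<open>g\<close> need not agree.\<close>
  define fn where "fn n a i = (if i < n then f (a i) else undefined)" for n :: nat and a i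
  define gn where "gn n a i = (if i < n then g (a i) else undefined)" for n :: nat and a i
  have common: "common_fn p f g"
    using gk by (simp add: gk_common_part_def)
  have finP: "finite (set_pmf P)" by simp
  have commonP: "f (vS1 v) = g (vS2 v)" if "v \<in> set_pmf P" for v
    using that common by (auto simp: P_def joint_dist_def vS1_def vS2_def common_fn_def)
  have u: "vW1 (unzip_joint h) = (\<lambda>i. vW1 (h i))" "vW2 (unzip_joint h) = (\<lambda>i. vW2 (h i))"
    "vY1 (unzip_joint h) = (\<lambda>i. vY1 (h i))" "vY2 (unzip_joint h) = (\<lambda>i. vY2 (h i))"
    for h :: "nat \<Rightarrow> 'q \<times> ('s1 \<times> 's2 \<times> 'w1 \<times> 'w2) \<times> 'x1 \<times> 'x2 \<times> ('y1 \<times> 'y2)"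
    by (simp_all add: unzip_joint_def vW1_def vW2_def vY1_def vY2_def)
  obtain c1 where c1: "1 < c1" "\<And>c. 1 < c \<Longrightarrow> c \<le> c1 \<Longrightarrow>
      (\<lambda>n. reject_prob (c ^ n) (Pn n) (fn n) (gn n) vW1 vY1) \<longlonglongrightarrow> 0"
    using reject_prob_tendsto_0[OF finP cond1[folded P_def] commonP u(1) u(3)]
    unfolding Pn_def joint_dist_iid_eq P_def[symmetric] fn_def[abs_def] gn_def[abs_def] by blast
  obtain c2 where c2: "1 < c2" "\<And>c. 1 < c \<Longrightarrow> c \<le> c2 \<Longrightarrow>
      (\<lambda>n. reject_prob (c ^ n) (Pn n) (fn n) (gn n) vW2 vY2) \<longlonglongrightarrow> 0"
    using reject_prob_tendsto_0[OF finP cond2[folded P_def] commonP u(2) u(4)]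
    unfolding Pn_def joint_dist_iid_eq P_def[symmetric] fn_def[abs_def] gn_def[abs_def] by blast
  \<comment> \<open>One threshold \<open>c ^ n\<close> has to work for both receivers.\<close>
  define c where "c = min c1 c2"
  have c: "1 < c" "c \<le> c1" "c \<le> c2" using c1(1) c2(1) by (auto simp: c_def)
  let ?err = "\<lambda>n. reject_prob (c ^ n) (Pn n) (fn n) (gn n) vW1 vY1
      + reject_prob (c ^ n) (Pn n) (fn n) (gn n) vW2 vY2 + 8 * inverse c ^ n"
  have "?err \<longlonglongrightarrow> 0 + 0 + 8 * 0"
    using c by (intro tendsto_intros c1(2) c2(2) LIMSEQ_realpow_zero) (auto simp: inverse_less_1_iff)
  then have "eventually (\<lambda>n. ?err n < \<epsilon>) sequentially"
    using \<open>0 < \<epsilon>\<close> by (auto intro: order_tendstoD)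
  \<comment> \<open>The same \<open>n\<close> is the number of source letters and of channel uses,
    which gives rate 1.\<close>
  then obtain n where n: "?err n < \<epsilon>" "0 < n"
    using eventually_happens[OF eventually_conj[OF _ eventually_gt_at_top[of 0]], of "\<lambda>n. ?err n < \<epsilon>"]
    by auto
  have "common_fn (map_pmf unzip4 (Pi_pmf {..<n} undefined (\<lambda>_. p))) (fn n) (gn n)"
    unfolding common_fn_def
  proof (intro allI impI)
    fix s1 s2 w1 w2
    assume "(s1, s2, w1, w2) \<in> set_pmf (map_pmf unzip4 (Pi_pmf {..<n} undefined (\<lambda>_. p)))"
    then obtain h where h: "h \<in> set_pmf (Pi_pmf {..<n} undefined (\<lambda>_. p))" "(s1, s2, w1, w2) = unzip4 h"
      by auto
    have "f (fst (h i)) = g (fst (snd (h i)))" if "i < n" for i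
    proof -
      have "h i \<in> set_pmf p" using h(1) that by (simp add: set_Pi_pmf PiE_dflt_def)
      then show ?thesis using common unfolding common_fn_def by (metis prod.collapse)
    qed
    then show "fn n s1 = gn n s2"
      using h(2) by (simp add: unzip4_def fn_def gn_def fun_eq_iff)
  qed
  moreover have "finite (set_pmf (Pn n))"
    unfolding Pn_def joint_dist_iid_eq by (simp add: finite_set_Pi_pmf)
  moreover have "finite (set_pmf (map_pmf unzip4 (Pi_pmf {..<n} undefined (\<lambda>_. p))))"
    by (simp add: finite_set_Pi_pmf)
  moreover have "0 < c ^ n" using c by simp
  moreover have "reject_prob (c ^ n) (Pn n) (fn n) (gn n) vW1 vY1
      + reject_prob (c ^ n) (Pn n) (fn n) (gn n) vW2 vY2 + 8 / c ^ n < \<epsilon>"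
    using n by (simp add: divide_inverse power_inverse)
  ultimately obtain enc1 enc2 dec1 dec2 where e:
    "(\<integral>\<^sup>+(a, b, w1, w2). \<integral>\<^sup>+(y1, y2). of_bool (dec1 y1 w1 \<noteq> (a, b) \<or> dec2 y2 w2 \<noteq> (a, b))
      \<partial>map_pmf unzip2 (Pi_pmf {..<n} undefined (\<lambda>i. W (enc1 a i) (enc2 b i)))
      \<partial>map_pmf unzip4 (Pi_pmf {..<n} undefined (\<lambda>_. p))) < ennreal \<epsilon>"
    unfolding Pn_def joint_dist_iid_def by (rule one_shot_code_exists)
  \<comment> \<open>Only positions below \<open>n\<close> count as errors, and a wrong letter there
    makes the decoded word differ from the true one.\<close>
  have "ennreal (mac_error_prob p W n n enc1 enc2 dec1 dec2) \<le>
    (\<integral>\<^sup>+(a, b, w1, w2). \<integral>\<^sup>+(y1, y2). of_bool (dec1 y1 w1 \<noteq> (a, b) \<or> dec2 y2 w2 \<noteq> (a, b))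
      \<partial>map_pmf unzip2 (Pi_pmf {..<n} undefined (\<lambda>i. W (enc1 a i) (enc2 b i)))
      \<partial>map_pmf unzip4 (Pi_pmf {..<n} undefined (\<lambda>_. p)))"
    unfolding mac_error_prob_eq split_def by (intro nn_integral_mono) auto
  also note e
  finally have "mac_error_prob p W n n enc1 enc2 dec1 dec2 < \<epsilon>"
    by (subst (asm) ennreal_less_iff) (simp_all add: mac_error_prob_def)
  then show "\<exists>m n enc1 enc2 dec1 dec2. m > 0 \<and> n > 0 \<and> real n / real m = 1 \<and>
      mac_error_prob p W m n enc1 enc2 dec1 dec2 < \<epsilon>"
    using n(2) by (intro exI[of _ n] exI[of _ enc1] exI[of _ enc2] exI[of _ dec1] exI[of _ dec2]) simp
qed

end
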